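(* Let $\mathcal{G}=(\mathcal{V},\mathcal{E})$ be an infinite triangle-free graph with maximum degree $\Delta=\max_{v\in\mathcal{V}}\Delta(v)<\infty$, and let $\mathcal{L}=(L(v):v\in\mathcal{V})$ be color lists with $L(v)\subseteq\{1,\dots,q\}$. Let $\alpha^*$ be the unique root of $xe^{-1/x}=1$. Suppose that for some constant $\alpha>\alpha^*$ and some constant $\beta\ge \frac{\sqrt2}{\sqrt2-1}$ with $$(1-1/\beta)\,\alpha\, e^{-\frac1\alpha(1+1/\beta)}>1,$$ we have $|L(v)|\ge \alpha\Delta(v)+\beta$ for every $v\in\mathcal{V}$. Then the Gibbs measure with the uniform specification on $(\mathcal{G},\mathcal{L})$ satisfies strong spatial mixing with exponentially decaying correlations; that is, there exist positive constants $A$ and $\theta$ such that for any finite region $\Psi\subset\mathcal{V}$, any two colorings $C_1,C_2$ of $\mathcal{V}\setminus\Psi$ (where free vertices, i.e. vertices to which no color is assigned, are also allowed) which differ only on a subset $W\subset\partial\Psi$, and any subset $\Lambda\subseteq\Psi$, $$\|\mu_\Psi^{C_1}-\mu_\Psi^{C_2}\|_\Lambda\le A\,|\Lambda|\,e^{-\theta d(\Lambda,W)}.$$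
   Context: $\Delta(v)$ is the degree of $v$ in $\mathcal{G}$. $d(v_1,v_2)$ is the graph distance (infinite if the vertices lie in different components); for finite vertex sets, $d(\Psi_1,\Psi_2)=\min\{d(v_1,v_2):v_1\in\Psi_1,v_2\in\Psi_2\}$, equal to $\infty$ if one of the sets is empty, and $e^{-\infty}=0$. $\partial\Psi$ is the set of vertices not in $\Psi$ that are adjacent to some vertex of $\Psi$. A (valid list) coloring of a set of vertices assigns to each vertex $u$ of the set a color $c(u)\in L(u)$ so that no two adjacent vertices of the set have the same color. A coloring with free vertices is a valid coloring of some subset of the vertices, the remaining ones (the free ones) being assigned no color. Two such colorings differ at $u$ if they assign different colors to $u$, or if exactly one of them assigns a color to $u$. For a coloring $C$ of $\mathcal{V}\setminus\Psi$ (possibly with free vertices), $\mu_\Psi^C$ is the uniform distribution on the valid list colorings of $\Psi$ in which no vertex of $\Psi$ has the same color as an adjacent vertex colored by $C$ (free vertices impose no constraint). The Gibbs measure with the uniform specification is a measure on valid list colorings of $\mathcal{G}$ whose conditional distribution on every finite region $\Psi$, given any coloring $C$ of $\mathcal{V}\setminus\Psi$, is $\mu_\Psi^C$. The total variational distance of two measures on a finite or countable set $\Omega$ is $\|\mu_1-\mu_2\|=\sum_{\omega\in\Omega}|\mu_1(\omega)-\mu_2(\omega)|$ (no factor $1/2$), and $\|\mu_\Psi^{C_1}-\mu_\Psi^{C_2}\|_\Lambda$ is the total variational distance between the restrictions (marginals) of the two distributions to the coloring of $\Lambda$. *)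

theory Defs
  imports "HOL-Probability.Probability" "HOL-Library.Extended_Nat"
begin

text \<open>
  A graph is given by its vertex set \<open>V\<close> and its adjacency relation \<open>E\<close>; it may be infinite.
\<close>

definition simple_graph :: "'v set \<Rightarrow> 'v rel \<Rightarrow> bool" where
  "simple_graph V E \<longleftrightarrow> E \<subseteq> V \<times> V \<and> sym E \<and> irrefl E"

definition triangle_free :: "'v rel \<Rightarrow> bool" where
  "triangle_free E \<longleftrightarrow> \<not> (\<exists>u v w. (u, v) \<in> E \<and> (v, w) \<in> E \<and> (w, u) \<in> E)"

definition vertex_degree :: "'v rel \<Rightarrow> 'v \<Rightarrow> nat" where
  "vertex_degree E v = card (E `` {v})"

text \<open>The finiteness clause is needed because \<open>card\<close> is \<open>0\<close> on infinite sets.\<close>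

definition has_max_degree :: "'v set \<Rightarrow> 'v rel \<Rightarrow> nat \<Rightarrow> bool" where
  "has_max_degree V E D \<longleftrightarrow>
     (\<forall>v\<in>V. finite (E `` {v}) \<and> vertex_degree E v \<le> D) \<and> (\<exists>v\<in>V. vertex_degree E v = D)"

definition boundary :: "'v rel \<Rightarrow> 'v set \<Rightarrow> 'v set" where
  "boundary E \<Psi> = E `` \<Psi> - \<Psi>"

text \<open>
  \<open>E ^^ n\<close> relates the endpoints of walks of length \<open>n\<close>. Infima over the empty set are \<open>\<infinity>\<close> in
  \<^typ>\<open>enat\<close>, which covers both disconnected vertices and empty sets.
\<close>

definition graph_dist :: "'v rel \<Rightarrow> 'v \<Rightarrow> 'v \<Rightarrow> enat" where
  "graph_dist E u v = (INF n \<in> {n. (u, v) \<in> E ^^ n}. enat n)"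

definition set_dist :: "'v rel \<Rightarrow> 'v set \<Rightarrow> 'v set \<Rightarrow> enat" where
  "set_dist E A B = (INF u \<in> A. INF v \<in> B. graph_dist E u v)"

text \<open>\<open>exp_decay \<theta> d\<close> is $e^{-\theta d}$ for \<open>\<theta> > 0\<close>, with $e^{-\infty} = 0$.\<close>

definition exp_decay :: "real \<Rightarrow> enat \<Rightarrow> real" where
  "exp_decay \<theta> d = (case d of enat n \<Rightarrow> exp (- \<theta> * real n) | \<infinity> \<Rightarrow> 0)"

text \<open>
  Colorings are partial maps; \<open>list_coloring E L U c\<close> says that \<open>c\<close> colors exactly the vertices
  in \<open>U\<close>. In a coloring with free vertices, these are the vertices outside the domain.
\<close>

definition list_coloring :: "'v rel \<Rightarrow> ('v \<Rightarrow> nat set) \<Rightarrow> 'v set \<Rightarrow> ('v \<Rightarrow> nat option) \<Rightarrow> bool" where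
  "list_coloring E L U c \<longleftrightarrow>
     dom c = U \<and> (\<forall>u\<in>U. the (c u) \<in> L u) \<and>
     (\<forall>u\<in>U. \<forall>v\<in>U. (u, v) \<in> E \<longrightarrow> c u \<noteq> c v)"

definition free_coloring :: "'v rel \<Rightarrow> ('v \<Rightarrow> nat set) \<Rightarrow> 'v set \<Rightarrow> ('v \<Rightarrow> nat option) \<Rightarrow> bool" where
  "free_coloring E L U c \<longleftrightarrow> (\<exists>U'\<subseteq>U. list_coloring E L U' c)"

definition compatible_colorings ::
  "'v rel \<Rightarrow> ('v \<Rightarrow> nat set) \<Rightarrow> 'v set \<Rightarrow> ('v \<Rightarrow> nat option) \<Rightarrow> ('v \<Rightarrow> nat option) set" where
  "compatible_colorings E L \<Psi> C =
     {c. list_coloring E L \<Psi> c \<and> (\<forall>u\<in>\<Psi>. \<forall>v\<in>dom C. (u, v) \<in> E \<longrightarrow> c u \<noteq> C v)}"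

definition cond_dist ::
  "'v rel \<Rightarrow> ('v \<Rightarrow> nat set) \<Rightarrow> 'v set \<Rightarrow> ('v \<Rightarrow> nat option) \<Rightarrow> ('v \<Rightarrow> nat option) pmf" where
  "cond_dist E L \<Psi> C = pmf_of_set (compatible_colorings E L \<Psi> C)"

text \<open>Total variational distance, without the factor $1/2$.\<close>

definition tv_dist :: "'a pmf \<Rightarrow> 'a pmf \<Rightarrow> real" where
  "tv_dist p q = (\<Sum>\<^sub>\<infinity>x. \<bar>pmf p x - pmf q x\<bar>)"

definition marginal :: "'v set \<Rightarrow> ('v \<Rightarrow> nat option) pmf \<Rightarrow> ('v \<Rightarrow> nat option) pmf" where
  "marginal \<Lambda> p = map_pmf (\<lambda>c. c |` \<Lambda>) p"

text \<open>
  The property concerns the specification \<^const>\<open>cond_dist\<close> only: the two boundary colorings may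
  have free vertices, so they are not restricted to those in the support of a Gibbs measure.
\<close>

definition strong_spatial_mixing :: "'v set \<Rightarrow> 'v rel \<Rightarrow> ('v \<Rightarrow> nat set) \<Rightarrow> bool" where
  "strong_spatial_mixing V E L \<longleftrightarrow>
     (\<exists>A \<theta>. 0 < A \<and> 0 < \<theta> \<and>
       (\<forall>\<Psi> C\<^sub>1 C\<^sub>2 W \<Lambda>.
          finite \<Psi> \<longrightarrow> \<Psi> \<subseteq> V \<longrightarrow>
          free_coloring E L (V - \<Psi>) C\<^sub>1 \<longrightarrow> free_coloring E L (V - \<Psi>) C\<^sub>2 \<longrightarrow>
          W \<subseteq> boundary E \<Psi> \<longrightarrow> {u. C\<^sub>1 u \<noteq> C\<^sub>2 u} \<subseteq> W \<longrightarrow> \<Lambda> \<subseteq> \<Psi> \<longrightarrow>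
          tv_dist (marginal \<Lambda> (cond_dist E L \<Psi> C\<^sub>1)) (marginal \<Lambda> (cond_dist E L \<Psi> C\<^sub>2))
            \<le> A * real (card \<Lambda>) * exp_decay \<theta> (set_dist E \<Lambda> W)))"

definition alpha_star :: real where
  "alpha_star = (THE x. x * exp (- 1 / x) = 1)"

text \<open>The root is unique among all reals: for \<open>x \<le> 0\<close> the left-hand side is not positive.\<close>

lemma ex1_alpha_star: "\<exists>!x::real. x * exp (- 1 / x) = 1"
proof -
  have mono: "x * exp (- 1 / x) < y * exp (- 1 / y)" if "0 < x" "x < y" for x y :: real
  proof (rule mult_strict_mono)
    show "exp (- 1 / x) < exp (- 1 / y)"
      using that by (simp add: frac_less2)
  qed (use that in auto)
  have "\<exists>x\<ge>1. x \<le> 3 \<and> x * exp (- 1 / x) = (1::real)"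
  proof (rule IVT')
    have "exp (1 / 3) \<le> exp (1::real)"
      by simp
    also have "\<dots> \<le> 3"
      by (rule exp_le)
    finally show "1 \<le> 3 * exp (- 1 / 3 :: real)"
      by (simp add: exp_minus field_simps)
    show "continuous_on {1..3} (\<lambda>x::real. x * exp (- 1 / x))"
      by (intro continuous_intros) auto
  qed auto
  then obtain a :: real where a: "1 \<le> a" "a * exp (- 1 / a) = 1"
    by blast
  show ?thesis
  proof (rule ex1I[of _ a])
    fix x :: real
    assume x: "x * exp (- 1 / x) = 1"
    then have "0 < x"
      using exp_gt_zero[of "- 1 / x"] zero_less_mult_pos2[of x "exp (- 1 / x)"] by simp
    then have "\<not> x < a" "\<not> a < x"
      using mono[of x a] mono[of a x] a x by fastforce+
    then show "x = a"
      by simp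
  qed (fact a(2))
qed

text \<open>
  If every list is longer than the degree, the set underlying \<^const>\<open>cond_dist\<close> is finite and
  nonempty, as \<^const>\<open>pmf_of_set\<close> requires.
\<close>

lemma finite_compatible_colorings:
  assumes "finite \<Psi>" and "\<And>v. v \<in> \<Psi> \<Longrightarrow> finite (L v)"
  shows "finite (compatible_colorings E L \<Psi> C)"
proof -
  have "compatible_colorings E L \<Psi> C \<subseteq> {c. dom c = \<Psi> \<and> ran c \<subseteq> \<Union> (L ` \<Psi>)}"
  proof
    fix c assume "c \<in> compatible_colorings E L \<Psi> C"
    then have c: "dom c = \<Psi>" "\<And>u. u \<in> \<Psi> \<Longrightarrow> the (c u) \<in> L u"
      by (simp_all add: compatible_colorings_def list_coloring_def)
    have "k \<in> \<Union> (L ` \<Psi>)" if k: "k \<in> ran c" for k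
    proof -
      obtain u where u: "c u = Some k"
        using k by (auto simp: ran_def)
      then have "u \<in> \<Psi>"
        using c(1) by blast
      with c(2)[of u] u show ?thesis
        by auto
    qed
    with c(1) show "c \<in> {c. dom c = \<Psi> \<and> ran c \<subseteq> \<Union> (L ` \<Psi>)}"
      by blast
  qed
  moreover have "finite {c. dom c = \<Psi> \<and> ran c \<subseteq> \<Union> (L ` \<Psi>)}"
    using assms by (intro finite_set_of_finite_maps) auto
  ultimately show ?thesis
    by (rule finite_subset)
qed

lemma compatible_colorings_nonempty:
  assumes "finite \<Psi>" and E: "sym E" "irrefl E"
    and "\<And>v. v \<in> \<Psi> \<Longrightarrow> finite (E `` {v}) \<and> vertex_degree E v < card (L v)"
    and "dom C \<inter> \<Psi> = {}"
  shows "compatible_colorings E L \<Psi> C \<noteq> {}"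
  using assms(1,4,5)
proof (induction \<Psi> rule: finite_induct)
  case empty
  have "Map.empty \<in> compatible_colorings E L {} C"
    by (simp add: compatible_colorings_def list_coloring_def)
  then show ?case by blast
next
  case (insert w \<Psi>)
  have "compatible_colorings E L \<Psi> C \<noteq> {}"
    using insert.prems by (intro insert.IH) auto
  then obtain c where c: "c \<in> compatible_colorings E L \<Psi> C"
    by blast
  define X where "X = (\<lambda>v. the (if v \<in> \<Psi> then c v else C v)) ` (E `` {w})"
  have fin: "finite (E `` {w})" and "vertex_degree E w < card (L w)"
    using insert.prems(1)[of w] by auto
  moreover have "card X \<le> vertex_degree E w"
    unfolding X_def vertex_degree_def by (rule card_image_le[OF fin])
  ultimately have "card X < card (L w)" "finite X"
    by (auto simp: X_def)
  then obtain k where k: "k \<in> L w" "k \<notin> X"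
    by (meson card_mono leD subsetI)
  have nw: "(w, w) \<notin> E"
    using E by (auto simp: irrefl_def)
  have X1: "c v \<noteq> Some k" if "(w, v) \<in> E \<or> (v, w) \<in> E" "v \<in> \<Psi>" for v
    using that k(2) symD[OF E(1)] by (force simp: X_def)
  have X2: "C v \<noteq> Some k" if "(w, v) \<in> E" "v \<notin> \<Psi>" for v
    using that k(2) by (force simp: X_def)
  have c1: "dom c = \<Psi>" "\<And>u. u \<in> \<Psi> \<Longrightarrow> the (c u) \<in> L u"
    "\<And>u v. u \<in> \<Psi> \<Longrightarrow> v \<in> \<Psi> \<Longrightarrow> (u, v) \<in> E \<Longrightarrow> c u \<noteq> c v"
    "\<And>u v. u \<in> \<Psi> \<Longrightarrow> v \<in> dom C \<Longrightarrow> (u, v) \<in> E \<Longrightarrow> c u \<noteq> C v"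
    using c unfolding compatible_colorings_def list_coloring_def by blast+
  let ?c = "c(w \<mapsto> k)"
  have "dom ?c = insert w \<Psi>"
    using c1(1) by simp
  moreover have "\<forall>u\<in>insert w \<Psi>. the (?c u) \<in> L u"
    using c1(2) k(1) by simp
  moreover have "\<forall>u\<in>insert w \<Psi>. \<forall>v\<in>insert w \<Psi>. (u, v) \<in> E \<longrightarrow> ?c u \<noteq> ?c v"
  proof (intro ballI impI)
    fix u v assume "u \<in> insert w \<Psi>" "v \<in> insert w \<Psi>" "(u, v) \<in> E"
    then show "?c u \<noteq> ?c v"
      using c1(3)[of u v] X1[of u] X1[of v] nw by (auto split: if_splits)
  qed
  moreover have "\<forall>u\<in>insert w \<Psi>. \<forall>v\<in>dom C. (u, v) \<in> E \<longrightarrow> ?c u \<noteq> C v"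
  proof (intro ballI impI)
    fix u v assume *: "u \<in> insert w \<Psi>" "v \<in> dom C" "(u, v) \<in> E"
    then have "v \<notin> \<Psi>"
      using insert.prems(2) by blast
    then show "?c u \<noteq> C v"
      using c1(4)[of u v] X2[of v] * by (auto split: if_splits)
  qed
  ultimately have "?c \<in> compatible_colorings E L (insert w \<Psi>) C"
    unfolding compatible_colorings_def list_coloring_def by blast
  then show ?case by blast
qed

end

theory Submission
  imports Defs
begin

text \<open>
  Coloring a vertex \<open>v\<close> with \<open>k\<close> and deleting it removes \<open>k\<close> from the lists of the neighbors of
  \<open>v\<close> and lowers their degrees by one, so the condition \<open>card (L u) \<ge> \<alpha> deg u + \<beta>\<close> survives. It
  bounds every marginal by \<open>1 / \<beta>\<close>. In a triangle-free graph it moreover bounds the marginals at a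
  vertex of degree \<open>d\<close> by \<open>1 / (\<kappa> d)\<close> with \<open>\<kappa> = \<alpha> exp (- (1 / \<alpha>) (1 + 1 / \<beta>))\<close>: given the rest of the
  coloring, the neighbors of \<open>v\<close> are independent, and Jensen's inequality applies to the sum over the
  colors of \<open>v\<close>.

  For two boundary conditions, with marginals \<open>x\<close> and \<open>y\<close> at \<open>v\<close>, consider the oscillation over the
  colors \<open>i\<close> of \<open>ln (x i / y i)\<close>. It is at most the sum, over the neighbors \<open>u\<close> of \<open>v\<close>, of the
  oscillations of \<open>ln ((1 - x i) / (1 - y i))\<close> at \<open>u\<close>, and passing from \<open>x\<close> to \<open>1 - x\<close> multiplies
  the oscillation by at most \<open>x / (1 - x) \<le> \<rho> / deg u\<close>, where \<open>\<rho> = 1 / ((1 - 1 / \<beta>) \<kappa>) < 1\<close>. So the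
  oscillation divided by the degree contracts by \<open>\<rho>\<close> in each step away from the disagreement. The
  marginals on \<open>\<Lambda>\<close> are then compared by revealing one vertex of \<open>\<Lambda>\<close> after the other.
\<close>

section \<open>Real inequalities\<close>

text \<open>On \<open>[0, 1/2]\<close> one has \<open>- ln (1 - x) \<le> x + x^2\<close>, and
  \<open>x^2 \<le> b * x\<close>. Used with \<open>b = 1 / \<beta>\<close>, this is the source of
  the factor \<open>1 + 1 / \<beta>\<close> in the exponent of the hypothesis.\<close>

lemma exp_le_one_minus:
  fixes x b :: real
  assumes "0 \<le> x" "x \<le> b" "b \<le> 1 / 2"
  shows "exp (- (1 + b) * x) \<le> 1 - x"
proof -
  have x: "x \<le> 1 / 2" using assms by simp
  have "0 \<le> x^2 / 2 * (1 - x - x^2 - x^3)"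
  proof -
    have "x^2 \<le> (1/2)^2" "x^3 \<le> (1/2)^3"
      using assms x by (intro power_mono; simp)+
    then show ?thesis using x by (simp add: power2_eq_square power3_eq_cube)
  qed
  also have "\<dots> = (1 - x) * (1 + (x + x^2) + (x + x^2)^2 / 2) - 1"
    by (simp add: field_simps power2_eq_square power3_eq_cube)
  also have "\<dots> \<le> (1 - x) * exp (x + x^2) - 1"
    using exp_lower_Taylor_quadratic[of "x + x^2"] assms x by (intro diff_right_mono mult_left_mono) auto
  finally have *: "1 \<le> (1 - x) * exp (x + x^2)" by simp
  have "x + x^2 \<le> (1 + b) * x"
    using assms by (simp add: algebra_simps power2_eq_square mult_right_mono)
  then have "(1 - x) * exp (x + x^2) \<le> (1 - x) * exp ((1 + b) * x)"
    using x by (intro mult_left_mono) auto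
  with * have "1 \<le> (1 - x) * exp ((1 + b) * x)" by linarith
  moreover have "exp (- (1 + b) * x) = 1 / exp ((1 + b) * x)"
    by (simp only: minus_mult_left[symmetric] exp_minus inverse_eq_divide)
  ultimately show ?thesis by (simp add: divide_le_eq)
qed

text \<open>As a function of \<open>ln x\<close>, \<open>ln (1 - x)\<close> has derivative
  \<open>- x / (1 - x)\<close>, whose size is largest at the larger argument; hence \<open>s\<close>
  is only tested at \<open>x\<close>. Applying \<open>ln t \<le> t - 1\<close> to
  \<open>(1 - y) / (1 - x)\<close> and to \<open>y / x\<close> replaces the mean value
  theorem.\<close>

lemma ln_one_minus_diff:
  fixes x y s :: real
  assumes "0 < y" "y \<le> x" "x < 1" "x \<le> s * (1 - x)"
  shows "ln (1 - x) \<le> ln (1 - y)" "ln (1 - y) - ln (1 - x) \<le> s * (ln x - ln y)"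
proof -
  show "ln (1 - x) \<le> ln (1 - y)" using assms by simp
  have "ln (1 - y) - ln (1 - x) = ln ((1 - y) / (1 - x))"
    using assms by (simp add: ln_div)
  also have "\<dots> \<le> (1 - y) / (1 - x) - 1"
    using assms by (intro ln_le_minus_one) simp
  also have "\<dots> = x / (1 - x) * (1 - y / x)"
    using assms by (simp add: field_simps)
  also have "\<dots> \<le> s * (1 - y / x)"
    using assms by (intro mult_right_mono) (auto simp: divide_le_eq)
  also have "\<dots> \<le> s * (ln x - ln y)"
  proof (rule mult_left_mono)
    show "1 - y / x \<le> ln x - ln y"
      using assms ln_le_minus_one[of "y / x"] by (simp add: ln_div)
    have "0 < s * (1 - x)" using assms by linarith
    then show "0 \<le> s" using assms by (simp add: zero_less_mult_iff)
  qed
  finally show "ln (1 - y) - ln (1 - x) \<le> s * (ln x - ln y)" .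
qed

text \<open>Functions with equal sums cannot be strictly ordered. This turns a bound on the
  oscillation of a log-ratio into a bound on the log-ratio itself.\<close>

lemma exists_ln_le:
  fixes x y :: "'a \<Rightarrow> real"
  assumes "finite A" "A \<noteq> {}" "\<And>k. k \<in> A \<Longrightarrow> 0 < x k" "\<And>k. k \<in> A \<Longrightarrow> 0 < y k"
    and "sum x A = sum y A"
  shows "\<exists>k\<in>A. ln (x k) \<le> ln (y k)"
proof (rule ccontr)
  assume "\<not> ?thesis"
  then have "y k < x k" if "k \<in> A" for k
    using assms that by (auto simp: not_le)
  then have "sum y A < sum x A" using assms by (intro sum_strict_mono) auto
  with assms show False by simp
qed

text \<open>Since the sums agree, the log-ratio \<open>\<delta>\<close> is neither positive
  throughout nor negative throughout, so \<open>\<epsilon>\<close> bounds its size. Each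
  \<open>e k\<close> has the sign opposite to \<open>\<delta> k\<close> and at most \<open>s\<close>
  times its size. Only the case \<open>\<delta> i < 0 \<le> \<delta> j\<close> needs both terms, and
  there \<open>\<delta> j - \<delta> i \<le> \<epsilon>\<close> gives the factor \<open>s\<close>
  instead of \<open>2 * s\<close>.\<close>

lemma ln_one_minus_contraction:
  fixes x y :: "'a \<Rightarrow> real"
  assumes A: "finite A" "\<And>k. k \<in> A \<Longrightarrow> 0 < x k" "\<And>k. k \<in> A \<Longrightarrow> 0 < y k" "sum x A = sum y A"
    and zero: "\<And>k. k \<notin> A \<Longrightarrow> x k = 0" "\<And>k. k \<notin> A \<Longrightarrow> y k = 0"
    and lt: "\<And>k. x k < 1" "\<And>k. y k < 1"
    and s: "0 \<le> s" "\<And>k. x k \<le> s * (1 - x k)" "\<And>k. y k \<le> s * (1 - y k)"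
    and osc: "\<And>i j. i \<in> A \<Longrightarrow> j \<in> A \<Longrightarrow> ln (x i) - ln (y i) - (ln (x j) - ln (y j)) \<le> \<epsilon>"
    and "0 \<le> \<epsilon>"
  shows "ln (1 - x i) - ln (1 - y i) - (ln (1 - x j) - ln (1 - y j)) \<le> s * \<epsilon>"
proof (cases "A = {}")
  case True
  then show ?thesis using zero s \<open>0 \<le> \<epsilon>\<close> by simp
next
  case False
  \<comment> \<open>Outside \<open>A\<close> both \<open>x k\<close> and \<open>y k\<close> vanish,
    so \<open>e k = 0\<close>; the value 0 for \<open>\<delta> k\<close> makes the bounds below
    valid for every color.\<close>
  define \<delta> where "\<delta> k = (if k \<in> A then ln (x k) - ln (y k) else 0)" for k
  define e where "e k = ln (1 - x k) - ln (1 - y k)" for k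
  obtain k1 k2 where k: "k1 \<in> A" "ln (x k1) \<le> ln (y k1)" "k2 \<in> A" "ln (y k2) \<le> ln (x k2)"
    using exists_ln_le[OF A(1) False, of x y] exists_ln_le[OF A(1) False, of y x] A by auto
  have range: "- \<epsilon> \<le> \<delta> k" "\<delta> k \<le> \<epsilon>" for k
    using osc[of k k1] osc[of k2 k] k \<open>0 \<le> \<epsilon>\<close> by (auto simp: \<delta>_def)
  have pos: "- (s * \<delta> k) \<le> e k \<and> e k \<le> 0" if "0 \<le> \<delta> k" for k
  proof (cases "k \<in> A")
    case True
    then have "y k \<le> x k" using that A by (simp add: \<delta>_def)
    then show ?thesis
      using ln_one_minus_diff[of "y k" "x k" s] True A lt s by (simp add: \<delta>_def e_def)
  qed (simp add: \<delta>_def e_def zero)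
  have neg: "0 \<le> e k \<and> e k \<le> - (s * \<delta> k)" if "\<delta> k \<le> 0" for k
  proof (cases "k \<in> A")
    case True
    then have "x k \<le> y k" using that A by (simp add: \<delta>_def)
    then show ?thesis
      using ln_one_minus_diff[of "x k" "y k" s] True A lt s by (simp add: \<delta>_def e_def algebra_simps)
  qed (simp add: \<delta>_def e_def zero)
  have m: "s * \<delta> k \<le> s * \<epsilon>" "s * (- \<delta> k) \<le> s * \<epsilon>" for k
    using range[of k] s by (intro mult_left_mono; simp)+
  have s\<epsilon>: "0 \<le> s * \<epsilon>" using s \<open>0 \<le> \<epsilon>\<close> by simp
  have "\<delta> j - \<delta> i \<le> \<epsilon>"
    using range[of i] range[of j] osc[of j i] by (auto simp: \<delta>_def)
  then have "s * (\<delta> j - \<delta> i) \<le> s * \<epsilon>"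
    using s(1) by (rule mult_left_mono)
  then have "s * \<delta> j - s * \<delta> i \<le> s * \<epsilon>" by (simp add: algebra_simps)
  then have "e i - e j \<le> s * \<epsilon>"
    using s\<epsilon> pos[of i] neg[of i] pos[of j] neg[of j] m[of i] m[of j]
    by (cases "0 \<le> \<delta> i"; cases "0 \<le> \<delta> j") auto
  then show ?thesis by (simp add: e_def)
qed

text \<open>As both sums are 1, comparison with \<open>k1\<close> and \<open>k2\<close> bounds every
  log-ratio by \<open>\<epsilon>\<close>. From \<open>1 - b / a \<le> ln a - ln b\<close>, each
  difference is then at most \<open>\<epsilon>\<close> times the larger value, hence at most
  \<open>\<epsilon>\<close> times the sum of both.\<close>

lemma sum_abs_diff_le_ln_osc:
  fixes x y :: "'a \<Rightarrow> real"
  assumes A: "finite A" "\<And>k. k \<in> A \<Longrightarrow> 0 < x k" "\<And>k. k \<in> A \<Longrightarrow> 0 < y k"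
    and sum: "sum x A = 1" "sum y A = 1"
    and osc: "\<And>i j. i \<in> A \<Longrightarrow> j \<in> A \<Longrightarrow> ln (x i) - ln (y i) - (ln (x j) - ln (y j)) \<le> \<epsilon>"
  shows "(\<Sum>k\<in>A. \<bar>x k - y k\<bar>) \<le> 2 * \<epsilon>"
proof -
  have ne: "A \<noteq> {}" using sum by auto
  obtain k1 k2 where k: "k1 \<in> A" "ln (x k1) \<le> ln (y k1)" "k2 \<in> A" "ln (y k2) \<le> ln (x k2)"
    using exists_ln_le[OF A(1) ne, of x y] exists_ln_le[OF A(1) ne, of y x] A sum by auto
  have e0: "0 \<le> \<epsilon>" using osc[of k1 k1] k by simp
  have *: "a - b \<le> a * \<epsilon>" if "0 < a" "0 < b" "ln a - ln b \<le> \<epsilon>" for a b :: real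
  proof -
    have "1 - b / a \<le> ln a - ln b"
      using that ln_le_minus_one[of "b / a"] by (simp add: ln_div)
    then have "a * (1 - b / a) \<le> a * \<epsilon>" using that by (intro mult_left_mono) auto
    then show ?thesis using that by (simp add: algebra_simps)
  qed
  have "\<bar>x k - y k\<bar> \<le> x k * \<epsilon> + y k * \<epsilon>" if "k \<in> A" for k
  proof -
    have "0 \<le> x k * \<epsilon>" "0 \<le> y k * \<epsilon>" using A(2,3)[OF that] e0 by auto
    moreover have "x k - y k \<le> x k * \<epsilon>"
      using *[of "x k" "y k"] osc[OF that k(1)] k(2) A(2,3)[OF that] by linarith
    moreover have "y k - x k \<le> y k * \<epsilon>"
      using *[of "y k" "x k"] osc[OF k(3) that] k(4) A(2,3)[OF that] by linarith
    ultimately show ?thesis by linarith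
  qed
  then have "(\<Sum>k\<in>A. \<bar>x k - y k\<bar>) \<le> (\<Sum>k\<in>A. x k * \<epsilon> + y k * \<epsilon>)"
    by (rule sum_mono)
  also have "\<dots> = 2 * \<epsilon>" using sum by (simp add: sum.distrib flip: sum_distrib_right)
  finally show ?thesis .
qed

text \<open>The right-hand side counts the colorings of a star whose center has list
  \<open>A\<close> and whose leaves \<open>u\<close> have lists \<open>B u\<close>. Dividing by the
  product of the \<open>card (B u)\<close> leaves a sum over \<open>i\<close> of products of
  \<open>1 - t u i\<close>, bounded below by exponentials and then by convexity.\<close>

lemma star_count_ge:
  fixes B :: "'v \<Rightarrow> 'c set" and b :: real
  assumes N: "finite N" "\<And>u. u \<in> N \<Longrightarrow> finite (B u)" "\<And>u. u \<in> N \<Longrightarrow> 1 \<le> b * card (B u)"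
    and A: "finite A" "A \<noteq> {}" and b: "0 \<le> b" "b \<le> 1 / 2"
  shows "card A * exp (- ((1 + b) * card N / card A)) * (\<Prod>u\<in>N. real (card (B u)))
    \<le> (\<Sum>i\<in>A. \<Prod>u\<in>N. real (card (B u - {i})))"
proof -
  \<comment> \<open>\<open>t u i\<close> is the probability of color \<open>i\<close> under the
    uniform choice from \<open>B u\<close>; \<open>z\<close> bounds the mean of
    \<open>(1 + b) * (\<Sum>u\<in>N. t u i)\<close> over \<open>i\<close> in \<open>A\<close>,
    because \<open>t u\<close> sums to at most 1.\<close>
  define t where "t u i = (if i \<in> B u then 1 / real (card (B u)) else 0)" for u i
  define z where "z = (1 + b) * card N / card A"
  have cpos: "0 < real (card (B u))" if "u \<in> N" for u
    using N(3)[OF that] by (cases "card (B u) = 0") auto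
  have fac: "real (card (B u)) * exp (- (1 + b) * t u i) \<le> real (card (B u - {i}))" if "u \<in> N" for u i
  proof -
    have "exp (- (1 + b) * t u i) \<le> 1 - t u i"
      using b N(3)[OF that] cpos[OF that]
      by (intro exp_le_one_minus) (auto simp: t_def divide_le_eq mult.commute)
    then have "card (B u) * exp (- (1 + b) * t u i) \<le> card (B u) * (1 - t u i)"
      by (intro mult_left_mono) auto
    also have "\<dots> = real (card (B u - {i}))"
      using cpos[OF that] N(2)[OF that]
      by (auto simp: t_def card_Diff_singleton algebra_simps of_nat_diff Suc_le_eq)
    finally show ?thesis .
  qed
  have tsum: "(\<Sum>i\<in>A. t u i) \<le> 1" if "u \<in> N" for u
  proof -
    have "(\<Sum>i\<in>A. t u i) = (\<Sum>i\<in>A \<inter> B u. 1 / real (card (B u)))"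
      using A by (simp only: t_def sum.inter_restrict)
    also have "\<dots> = card (A \<inter> B u) / card (B u)" by simp
    also have "\<dots> \<le> 1"
      using cpos[OF that] N(2)[OF that] by (simp add: divide_le_eq card_mono)
    finally show ?thesis .
  qed
  have cA: "0 < real (card A)" using A by (simp add: card_gt_0_iff)
  have P0: "0 \<le> (\<Prod>u\<in>N. real (card (B u)))" by (simp add: prod_nonneg)
  have e: "(\<Prod>u\<in>N. exp (- (1 + b) * t u i)) = exp (- ((1 + b) * (\<Sum>u\<in>N. t u i)))" for i
    using exp_sum[OF N(1), of "\<lambda>u. - (1 + b) * t u i"] by (simp only: mult_minus_left sum_negf sum_distrib_left)
  \<comment> \<open>Jensen's inequality by hand: \<open>exp\<close> lies above its tangent at
    \<open>- z\<close>, and the linear terms add up to something nonnegative.\<close>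
  have "real (card A) * exp (- z) = exp (- z) * (card A - (1 + b) * card N + z * card A)"
    using cA by (simp add: z_def)
  also have "\<dots> \<le> exp (- z) * (card A - (1 + b) * (\<Sum>u\<in>N. \<Sum>i\<in>A. t u i) + z * card A)"
  proof (intro mult_left_mono add_right_mono diff_left_mono)
    show "(\<Sum>u\<in>N. \<Sum>i\<in>A. t u i) \<le> card N"
      using sum_mono[of N "\<lambda>u. \<Sum>i\<in>A. t u i" "\<lambda>_. 1"] tsum by simp
  qed (use b in auto)
  also have "\<dots> = (\<Sum>i\<in>A. exp (- z) * (1 + (z - (1 + b) * (\<Sum>u\<in>N. t u i))))"
    by (simp add: sum.distrib sum_subtractf algebra_simps sum.swap[of t A N]
        flip: sum_distrib_left sum_distrib_right)
  also have "\<dots> \<le> (\<Sum>i\<in>A. exp (- z) * exp (z - (1 + b) * (\<Sum>u\<in>N. t u i)))"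
    by (intro sum_mono mult_left_mono exp_ge_add_one_self) auto
  also have "\<dots> = (\<Sum>i\<in>A. \<Prod>u\<in>N. exp (- (1 + b) * t u i))"
    by (intro sum.cong refl) (simp only: e flip: exp_add, simp)
  finally have "card A * exp (- z) * (\<Prod>u\<in>N. real (card (B u)))
      \<le> (\<Sum>i\<in>A. \<Prod>u\<in>N. exp (- (1 + b) * t u i)) * (\<Prod>u\<in>N. real (card (B u)))"
    using P0 by (rule mult_right_mono)
  also have "\<dots> = (\<Sum>i\<in>A. \<Prod>u\<in>N. real (card (B u)) * exp (- (1 + b) * t u i))"
    by (simp only: prod.distrib sum_distrib_left mult.commute[of _ "\<Prod>u\<in>N. real (card (B u))"])
  also have "\<dots> \<le> (\<Sum>i\<in>A. \<Prod>u\<in>N. real (card (B u - {i})))"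
    by (intro sum_mono prod_mono) (use fac in auto)
  finally show ?thesis by (simp add: z_def)
qed

section \<open>Counting list colorings\<close>

definition colorings :: "'v rel \<Rightarrow> ('v \<Rightarrow> nat set) \<Rightarrow> 'v set \<Rightarrow> ('v \<Rightarrow> nat option) set" where
  "colorings E \<l> S = {c. list_coloring E \<l> S c}"

definition num :: "'v rel \<Rightarrow> ('v \<Rightarrow> nat set) \<Rightarrow> 'v set \<Rightarrow> real" where
  "num E \<l> S = real (card (colorings E \<l> S))"

definition forbid :: "'v rel \<Rightarrow> 'v \<Rightarrow> nat \<Rightarrow> ('v \<Rightarrow> nat set) \<Rightarrow> 'v \<Rightarrow> nat set" where
  "forbid E v k \<l> = (\<lambda>u. if (v, u) \<in> E then \<l> u - {k} else \<l> u)"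

text \<open>The event that \<open>v\<close> gets color \<open>k\<close> is expressed by shrinking
  the list of \<open>v\<close>, so the recursions for \<open>num\<close> apply to it, and colors
  outside the list get probability 0.\<close>

definition prob :: "'v rel \<Rightarrow> ('v \<Rightarrow> nat set) \<Rightarrow> 'v set \<Rightarrow> 'v \<Rightarrow> nat \<Rightarrow> real" where
  "prob E \<l> S v k = num E (\<l>(v := \<l> v \<inter> {k})) S / num E \<l> S"

definition deg :: "'v rel \<Rightarrow> 'v set \<Rightarrow> 'v \<Rightarrow> nat" where
  "deg E S v = card (S \<inter> E `` {v})"

lemma colorings_cong: "(\<And>u. u \<in> S \<Longrightarrow> \<l> u = \<l>' u) \<Longrightarrow> colorings E \<l> S = colorings E \<l>' S"
  by (auto simp: colorings_def list_coloring_def)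

lemma num_cong: "(\<And>u. u \<in> S \<Longrightarrow> \<l> u = \<l>' u) \<Longrightarrow> num E \<l> S = num E \<l>' S"
  by (simp add: num_def cong: colorings_cong)

lemma num_nonneg [simp]: "0 \<le> num E \<l> S"
  by (simp add: num_def)

lemma colorings_empty: "colorings E \<l> {} = {Map.empty}"
  by (auto simp: colorings_def list_coloring_def)

lemma finite_colorings:
  assumes "finite S" "\<And>u. u \<in> S \<Longrightarrow> finite (\<l> u)"
  shows "finite (colorings E \<l> S)"
  using finite_compatible_colorings[of S \<l> E Map.empty] assms
  by (simp add: compatible_colorings_def colorings_def)

text \<open>The basic recursion: the constraint that \<open>v\<close> imposes on its neighbors is
  absorbed into their lists, which leaves a list coloring problem on one vertex fewer.\<close>

lemma bij_betw_colorings_split: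
  assumes E: "sym E" "irrefl E" and v: "v \<in> S"
  shows "bij_betw (\<lambda>(k, c). c(v \<mapsto> k))
    (SIGMA k:\<l> v. colorings E (forbid E v k \<l>) (S - {v})) (colorings E \<l> S)"
proof (rule bij_betw_byWitness[where f' = "\<lambda>c. (the (c v), c(v := None))"])
  show "(\<lambda>(k, c). c(v \<mapsto> k)) ` (SIGMA k:\<l> v. colorings E (forbid E v k \<l>) (S - {v})) \<subseteq> colorings E \<l> S"
  proof clarify
    fix k c assume k: "k \<in> \<l> v" and "c \<in> colorings E (forbid E v k \<l>) (S - {v})"
    then have c: "dom c = S - {v}" "\<And>u. u \<in> S - {v} \<Longrightarrow> the (c u) \<in> forbid E v k \<l> u"
      "\<And>u w. u \<in> S - {v} \<Longrightarrow> w \<in> S - {v} \<Longrightarrow> (u, w) \<in> E \<Longrightarrow> c u \<noteq> c w"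
      by (auto simp: colorings_def list_coloring_def)
    have "the (c u) \<in> \<l> u" if "u \<in> S - {v}" for u
      using c(2)[OF that] by (auto simp: forbid_def split: if_splits)
    moreover have neq: "c u \<noteq> Some k" if "u \<in> S - {v}" "(v, u) \<in> E" for u
      using c(2)[OF that(1)] that(2) by (auto simp: forbid_def)
    have "(c(v \<mapsto> k)) u \<noteq> (c(v \<mapsto> k)) w" if uw: "u \<in> S" "w \<in> S" "(u, w) \<in> E" for u w
    proof -
      consider "u = v" "w \<noteq> v" | "u \<noteq> v" "w = v" | "u \<noteq> v" "w \<noteq> v"
        using uw(3) E(2) by (auto simp: irrefl_def)
      then show ?thesis
      proof cases
        case 1
        then show ?thesis using neq[of w] uw by force
      next
        case 2
        then show ?thesis using neq[of u] uw symD[OF E(1)] by auto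
      next
        case 3
        then show ?thesis using c(3)[of u w] uw by simp
      qed
    qed
    ultimately show "c(v \<mapsto> k) \<in> colorings E \<l> S"
      using c(1) v k by (auto simp: colorings_def list_coloring_def)
  qed
  show "(\<lambda>c. (the (c v), c(v := None))) ` colorings E \<l> S
      \<subseteq> (SIGMA k:\<l> v. colorings E (forbid E v k \<l>) (S - {v}))"
  proof clarify
    fix c assume "c \<in> colorings E \<l> S"
    then have c: "dom c = S" "\<And>u. u \<in> S \<Longrightarrow> the (c u) \<in> \<l> u"
      "\<And>u w. u \<in> S \<Longrightarrow> w \<in> S \<Longrightarrow> (u, w) \<in> E \<Longrightarrow> c u \<noteq> c w"
      by (auto simp: colorings_def list_coloring_def)
    have "the (c u) \<noteq> the (c v)" if "u \<in> S" "(v, u) \<in> E" for u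
      using c(1) c(3)[OF v that] v that by (metis domIff option.expand)
    then have "c(v := None) \<in> colorings E (forbid E v (the (c v)) \<l>) (S - {v})"
      using c by (auto simp: colorings_def list_coloring_def forbid_def)
    then show "the (c v) \<in> \<l> v \<and> c(v := None) \<in> colorings E (forbid E v (the (c v)) \<l>) (S - {v})"
      using c(2)[OF v] by simp
  qed
  show "\<forall>a\<in>SIGMA k:\<l> v. colorings E (forbid E v k \<l>) (S - {v}).
      (\<lambda>c. (the (c v), c(v := None))) ((\<lambda>(k, c). c(v \<mapsto> k)) a) = a"
  proof
    fix a assume "a \<in> (SIGMA k:\<l> v. colorings E (forbid E v k \<l>) (S - {v}))"
    then obtain k c where a: "a = (k, c)" and "c \<in> colorings E (forbid E v k \<l>) (S - {v})"
      by auto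
    then have "v \<notin> dom c" by (auto simp: colorings_def list_coloring_def)
    then show "(\<lambda>c. (the (c v), c(v := None))) ((\<lambda>(k, c). c(v \<mapsto> k)) a) = a"
      by (auto simp: a fun_eq_iff domIff)
  qed
  show "\<forall>c\<in>colorings E \<l> S. (\<lambda>(k, c). c(v \<mapsto> k)) ((\<lambda>c. (the (c v), c(v := None))) c) = c"
    using v by (auto simp: colorings_def list_coloring_def fun_eq_iff)
qed

lemma finite_forbid: "finite (\<l> u) \<Longrightarrow> finite (forbid E v k \<l> u)"
  by (simp add: forbid_def)

lemma sum_colorings:
  fixes g :: "('v \<Rightarrow> nat option) \<Rightarrow> real"
  assumes "sym E" "irrefl E" "v \<in> S" "finite S" "\<And>u. u \<in> S \<Longrightarrow> finite (\<l> u)"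
  shows "sum g (colorings E \<l> S)
    = (\<Sum>k\<in>\<l> v. \<Sum>c\<in>colorings E (forbid E v k \<l>) (S - {v}). g (c(v \<mapsto> k)))"
proof -
  have "sum g (colorings E \<l> S)
      = (\<Sum>p\<in>(SIGMA k:\<l> v. colorings E (forbid E v k \<l>) (S - {v})). g ((\<lambda>(k, c). c(v \<mapsto> k)) p))"
    using sum.reindex_bij_betw[OF bij_betw_colorings_split[OF assms(1-3)]] by metis
  also have "\<dots> = (\<Sum>k\<in>\<l> v. \<Sum>c\<in>colorings E (forbid E v k \<l>) (S - {v}). g (c(v \<mapsto> k)))"
    using assms by (subst sum.Sigma) (auto intro!: finite_colorings finite_forbid simp: split_def)
  finally show ?thesis .
qed

lemma num_split:
  assumes "sym E" "irrefl E" "v \<in> S" "finite S" "\<And>u. u \<in> S \<Longrightarrow> finite (\<l> u)"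
  shows "num E \<l> S = (\<Sum>k\<in>\<l> v. num E (forbid E v k \<l>) (S - {v}))"
  using sum_colorings[OF assms(1-4), of \<l> "\<lambda>_. 1"] assms(5) by (simp add: num_def)

text \<open>The list of \<open>v\<close> does not enter the counts on \<open>S - {v}\<close>, so
  changing it only changes the range of the sum.\<close>

lemma num_update:
  assumes "sym E" "irrefl E" "v \<in> S" "finite S" "\<And>u. u \<in> S \<Longrightarrow> finite (\<l> u)" "finite X"
  shows "num E (\<l>(v := X)) S = (\<Sum>k\<in>X. num E (forbid E v k \<l>) (S - {v}))"
proof -
  have "num E (forbid E v k (\<l>(v := X))) (S - {v}) = num E (forbid E v k \<l>) (S - {v})" for k
    by (rule num_cong) (auto simp: forbid_def)
  then show ?thesis
    using num_split[of E v S "\<l>(v := X)"] assms by simp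
qed

lemma num_update_Diff:
  assumes "sym E" "irrefl E" "v \<in> S" "finite S" "\<And>u. u \<in> S \<Longrightarrow> finite (\<l> u)" "0 < num E \<l> S"
  shows "num E (\<l>(v := \<l> v - {k})) S = num E \<l> S * (1 - prob E \<l> S v k)"
proof -
  have "num E (\<l>(v := \<l> v - {k})) S + num E (\<l>(v := \<l> v \<inter> {k})) S = num E \<l> S"
    using assms sum.Int_Diff[of "\<l> v" "\<lambda>i. num E (forbid E v i \<l>) (S - {v})" "{k}"]
    by (simp add: num_update num_split[of E v S \<l>] del: Diff_insert0)
  then show ?thesis using assms(6) by (simp add: prob_def right_diff_distrib)
qed

lemma prob_eq:
  assumes "sym E" "irrefl E" "v \<in> S" "finite S" "\<And>u. u \<in> S \<Longrightarrow> finite (\<l> u)"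
  shows "prob E \<l> S v k
    = (if k \<in> \<l> v then num E (forbid E v k \<l>) (S - {v}) / num E \<l> S else 0)"
proof -
  have "\<l> v \<inter> {k} = (if k \<in> \<l> v then {k} else {})" by auto
  then show ?thesis using assms by (simp add: prob_def num_update)
qed

lemma num_independent:
  assumes "sym E" "irrefl E" "finite S" "\<And>u. u \<in> S \<Longrightarrow> finite (\<l> u)"
    and "\<And>u w. u \<in> S \<Longrightarrow> w \<in> S \<Longrightarrow> (u, w) \<notin> E"
  shows "num E \<l> S = (\<Prod>u\<in>S. real (card (\<l> u)))"
  using assms(3-5)
proof (induction S rule: finite_induct)
  case empty
  then show ?case by (simp add: num_def colorings_empty)
next
  case (insert v S)
  have "num E (forbid E v k \<l>) S = num E \<l> S" for k
    using insert.prems by (intro num_cong) (auto simp: forbid_def)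
  then have "num E \<l> (insert v S) = (\<Sum>k\<in>\<l> v. num E \<l> S)"
    using insert.prems insert.hyps by (subst num_split[OF assms(1,2), of v]) auto
  then show ?case using insert by simp
qed

section \<open>Bounds on the marginals\<close>

text \<open>\<open>1 \<le> \<alpha>\<close> pays for the color that a vertex may lose when a
  neighbor is colored; \<open>2 \<le> \<beta>\<close> makes \<open>b = 1 / \<beta>\<close>
  admissible in \<open>star_count_ge\<close>.\<close>

locale list_coloring_setup =
  fixes E :: "'v rel" and \<alpha> \<beta> :: real
  assumes sym: "sym E" and irrefl: "irrefl E" and triangle_free: "triangle_free E"
    and alpha: "1 \<le> \<alpha>" and beta: "2 \<le> \<beta>"
begin

lemma symE: "(u, v) \<in> E \<Longrightarrow> (v, u) \<in> E"
  using sym by (rule symD)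

lemma irreflE: "(u, u) \<notin> E"
  using irrefl by (simp add: irrefl_def)

definition good :: "('v \<Rightarrow> nat set) \<Rightarrow> 'v set \<Rightarrow> bool" where
  "good \<l> S \<longleftrightarrow> finite S \<and>
     (\<forall>u\<in>S. finite (\<l> u) \<and> \<alpha> * real (deg E S u) + \<beta> \<le> real (card (\<l> u)))"

lemma goodD:
  assumes "good \<l> S"
  shows "finite S" "u \<in> S \<Longrightarrow> finite (\<l> u)"
    "u \<in> S \<Longrightarrow> \<alpha> * real (deg E S u) + \<beta> \<le> real (card (\<l> u))"
  using assms by (auto simp: good_def)

lemma good_card_ge: "good \<l> S \<Longrightarrow> u \<in> S \<Longrightarrow> \<beta> \<le> real (card (\<l> u))"
  using goodD(3)[of \<l> S u] alpha by (smt (verit) mult_nonneg_nonneg of_nat_0_le_iff)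

lemma good_list_nonempty: "good \<l> S \<Longrightarrow> u \<in> S \<Longrightarrow> \<l> u \<noteq> {}"
  using good_card_ge[of \<l> S u] beta by auto

lemma deg_Diff:
  assumes "finite S" "w \<in> S"
  shows "deg E S u = deg E (S - {w}) u + (if (w, u) \<in> E then 1 else 0)"
proof -
  have "w \<in> S \<inter> E `` {u} \<longleftrightarrow> (w, u) \<in> E" using symE assms(2) by blast
  moreover have "(S - {w}) \<inter> E `` {u} = S \<inter> E `` {u} - {w}" by blast
  ultimately show ?thesis
    using assms(1) card_Suc_Diff1[of "S \<inter> E `` {u}" w] by (simp add: deg_def)
qed

text \<open>A neighbor of \<open>w\<close> loses one from its degree, which lowers the required list
  size by \<open>\<alpha> \<ge> 1\<close> and so covers one lost color. The lists \<open>m\<close>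
  are general because the contraction step mixes two forbidden colors.\<close>

lemma good_Diff:
  assumes "good \<l> S" "w \<in> S"
    and "\<And>u. u \<in> S - {w} \<Longrightarrow> finite (m u)"
    and "\<And>u. u \<in> S - {w} \<Longrightarrow> card (\<l> u) \<le> card (m u) + (if (w, u) \<in> E then 1 else 0)"
  shows "good m (S - {w})"
  unfolding good_def
proof (intro conjI ballI)
  fix u assume u: "u \<in> S - {w}"
  have "\<alpha> * real (deg E S u) + \<beta> \<le> real (card (\<l> u))"
    using goodD(3)[OF assms(1)] u by blast
  moreover have "deg E S u = deg E (S - {w}) u + (if (w, u) \<in> E then 1 else 0)"
    using deg_Diff goodD(1)[OF assms(1)] assms(2) .
  ultimately show "\<alpha> * real (deg E (S - {w}) u) + \<beta> \<le> real (card (m u))"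
    using assms(4)[OF u] alpha by (auto simp: algebra_simps split: if_splits)
qed (use assms goodD in auto)

lemma good_forbid:
  assumes "good \<l> S" "w \<in> S"
  shows "good (forbid E w k \<l>) (S - {w})"
proof (rule good_Diff[OF assms])
  fix u assume "u \<in> S - {w}"
  then have "finite (\<l> u)" using goodD(2)[OF assms(1)] by blast
  then show "finite (forbid E w k \<l> u)"
    "card (\<l> u) \<le> card (forbid E w k \<l> u) + (if (w, u) \<in> E then 1 else 0)"
    by (auto simp: forbid_def card_Diff_singleton_if)
qed

lemma num_pos: "good \<l> S \<Longrightarrow> 0 < num E \<l> S"
proof (induction "card S" arbitrary: S \<l>)
  case 0
  then have "S = {}" using goodD(1) by auto
  then show ?case by (simp add: num_def colorings_empty)
next
  case (Suc n)
  then obtain v where v: "v \<in> S" by fastforce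
  have "0 < num E (forbid E v k \<l>) (S - {v})" for k
    using Suc v goodD(1)[OF Suc.prems] by (intro Suc.hyps(1) good_forbid) auto
  moreover have "finite (\<l> v)" "\<l> v \<noteq> {}"
    using Suc.prems v by (auto dest: goodD(2) good_list_nonempty)
  ultimately show ?case
    using v goodD[OF Suc.prems] by (subst num_split[OF sym irrefl v]) (auto intro!: sum_pos)
qed

lemma prob_good:
  assumes "good \<l> S" "v \<in> S"
  shows "prob E \<l> S v k = (if k \<in> \<l> v then num E (forbid E v k \<l>) (S - {v}) / num E \<l> S else 0)"
  using prob_eq[OF sym irrefl assms(2)] goodD[OF assms(1)] by blast

lemma prob_pos: "good \<l> S \<Longrightarrow> v \<in> S \<Longrightarrow> k \<in> \<l> v \<Longrightarrow> 0 < prob E \<l> S v k"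
  by (simp add: prob_good num_pos good_forbid)

lemma sum_prob: "good \<l> S \<Longrightarrow> v \<in> S \<Longrightarrow> (\<Sum>k\<in>\<l> v. prob E \<l> S v k) = 1"
  using num_split[OF sym irrefl, of v S \<l>] num_pos[of \<l> S] goodD[of \<l> S]
  by (simp add: prob_good flip: sum_divide_distrib)

text \<open>By the law of total probability, the marginal at \<open>v\<close> is a convex
  combination of the marginals that remain after \<open>R\<close> has been colored. The implication
  about \<open>m v\<close> records that only neighbors of \<open>v\<close> can shorten its
  list.\<close>

lemma prob_le_by_conditioning:
  assumes "good \<l> S" "v \<in> S" "R \<subseteq> S - {v}"
    and "\<And>m. good m (S - R) \<Longrightarrow> (R \<inter> E `` {v} = {} \<Longrightarrow> m v = \<l> v) \<Longrightarrow> prob E m (S - R) v j \<le> b"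
  shows "prob E \<l> S v j \<le> b"
proof -
  have "finite R" using assms(1,3) goodD(1) finite_subset by blast
  then show ?thesis using assms
  proof (induction R arbitrary: S \<l> rule: finite_induct)
    case empty
    then show ?case by simp
  next
    case (insert w R)
    have w: "w \<in> S" "w \<noteq> v" using insert.prems by auto
    have S: "finite S" "\<And>u. u \<in> S \<Longrightarrow> finite (\<l> u)" using goodD[OF insert.prems(1)] by auto
    let ?f = "\<lambda>k. forbid E w k \<l>"
    have le: "num E (\<l>(v := \<l> v \<inter> {j})) S \<le> b * num E \<l> S"
    proof -
      have "num E (\<l>(v := \<l> v \<inter> {j})) S
          = (\<Sum>k\<in>\<l> w. num E (forbid E w k (\<l>(v := \<l> v \<inter> {j}))) (S - {w}))"
        using num_split[OF sym irrefl w(1), of "\<l>(v := \<l> v \<inter> {j})"] S w by auto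
      also have "\<dots> \<le> (\<Sum>k\<in>\<l> w. b * num E (?f k) (S - {w}))"
      proof (rule sum_mono)
        fix k assume "k \<in> \<l> w"
        have g: "good (?f k) (S - {w})" using insert.prems(1) w(1) by (rule good_forbid)
        have "prob E (?f k) (S - {w}) v j \<le> b"
        proof (rule insert.IH[OF g])
          fix m assume m: "good m (S - {w} - R)" "R \<inter> E `` {v} = {} \<Longrightarrow> m v = ?f k v"
          have eq: "S - insert w R = S - {w} - R" by auto
          show "prob E m (S - {w} - R) v j \<le> b"
            unfolding eq[symmetric]
          proof (rule insert.prems(4))
            show "good m (S - insert w R)" unfolding eq by (rule m(1))
            assume "insert w R \<inter> E `` {v} = {}"
            then have "R \<inter> E `` {v} = {}" "(w, v) \<notin> E" using symE by blast+
            then show "m v = \<l> v" using m(2) by (simp add: forbid_def)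
          qed
        qed (use insert.prems insert.hyps w in auto)
        moreover have "forbid E w k (\<l>(v := \<l> v \<inter> {j})) = (?f k)(v := ?f k v \<inter> {j})"
          by (auto simp: forbid_def fun_eq_iff)
        ultimately show "num E (forbid E w k (\<l>(v := \<l> v \<inter> {j}))) (S - {w}) \<le> b * num E (?f k) (S - {w})"
          using num_pos[OF g] by (simp add: prob_def divide_le_eq)
      qed
      also have "\<dots> = b * num E \<l> S"
        using num_split[OF sym irrefl w(1) S] by (simp add: sum_distrib_left)
      finally show ?thesis .
    qed
    then show ?case using num_pos[OF insert.prems(1)] by (simp add: prob_def divide_le_eq)
  qed
qed

text \<open>Once all other vertices are colored, the color of \<open>v\<close> is uniform on a list
  that still has at least \<open>\<beta>\<close> colors.\<close>

lemma prob_le_inverse_beta: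
  assumes "good \<l> S" "v \<in> S"
  shows "prob E \<l> S v j \<le> 1 / \<beta>"
proof (rule prob_le_by_conditioning[OF assms, of "S - {v}"])
  fix m assume "good m (S - (S - {v}))"
  moreover have "S - (S - {v}) = {v}" using assms by auto
  ultimately have m: "good m {v}" by simp
  have "num E m' {v} = card (m' v)" if "finite (m' v)" for m'
    using num_independent[OF sym irrefl, of "{v}" m'] that irreflE by auto
  then have "prob E m {v} v j = card (m v \<inter> {j}) / card (m v)"
    using goodD(2)[OF m, of v] by (simp add: prob_def)
  also have "\<dots> \<le> 1 / card (m v)"
    using card_mono[of "{j}" "m v \<inter> {j}"] by (intro divide_right_mono) auto
  also have "\<dots> \<le> 1 / \<beta>"
    using good_card_ge[OF m, of v] beta by (intro divide_left_mono) auto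
  finally show "prob E m (S - (S - {v})) v j \<le> 1 / \<beta>"
    by (simp add: \<open>S - (S - {v}) = {v}\<close>)
qed auto

text \<open>Given the colors of all vertices other than \<open>v\<close> and its neighbors, the neighbors, being
  pairwise nonadjacent, only interact through \<open>v\<close>.\<close>

lemma prob_deg_le:
  assumes g: "good \<l> S" and v: "v \<in> S"
  shows "prob E \<l> S v j * deg E S v \<le> 1 / (\<alpha> * exp (- (1 / \<alpha>) * (1 + 1 / \<beta>)))"
proof (cases "deg E S v = 0")
  case True
  then show ?thesis using alpha by simp
next
  case False
  define N where "N = S \<inter> E `` {v}"
  have N: "finite N" "card N = deg E S v" "v \<notin> N"
    using goodD(1)[OF g] irreflE by (auto simp: N_def deg_def)
  define a where "a = real (card (\<l> v))"
  have a: "\<alpha> * deg E S v \<le> a" using goodD(3)[OF g v] beta by (simp add: a_def)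
  have a0: "0 < \<alpha> * deg E S v" using alpha False by simp
  define z where "z = (1 + 1 / \<beta>) * deg E S v / a"
  have "prob E \<l> S v j \<le> 1 / (a * exp (- z))"
  proof (rule prob_le_by_conditioning[OF g v, of "S - {v} - N"])
    fix m assume m: "good m (S - (S - {v} - N))" "(S - {v} - N) \<inter> E `` {v} = {} \<Longrightarrow> m v = \<l> v"
    have eq: "S - (S - {v} - N) = insert v N" using v by (auto simp: N_def)
    have g': "good m (insert v N)" using m(1) by (simp only: eq)
    \<comment> \<open>The conditioned vertices include no neighbor of \<open>v\<close>, so
      \<open>v\<close> keeps all of its \<open>a\<close> colors.\<close>
    have mv: "m v = \<l> v" using m(2) by (auto simp: N_def)
    have indep: "(u, w) \<notin> E" if "u \<in> N" "w \<in> N" for u w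
      using that triangle_free symE unfolding N_def triangle_free_def by blast
    have fin: "finite (m u)" if "u \<in> insert v N" for u using goodD(2)[OF g' that] .
    have num_i: "num E (forbid E v i m) N = (\<Prod>u\<in>N. real (card (m u - {i})))" for i
    proof -
      have "num E (forbid E v i m) N = (\<Prod>u\<in>N. real (card (forbid E v i m u)))"
        using indep fin by (intro num_independent[OF sym irrefl N(1)]) (auto intro: finite_forbid)
      then show ?thesis by (simp add: forbid_def N_def)
    qed
    have num_eq: "num E m (insert v N) = (\<Sum>i\<in>\<l> v. \<Prod>u\<in>N. real (card (m u - {i})))"
      using num_split[OF sym irrefl, of v "insert v N" m] N fin mv by (simp add: num_i)
    define P where "P = (\<Prod>u\<in>N. real (card (m u)))"
    have "a * exp (- z) * P \<le> num E m (insert v N)"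
    proof -
      have "1 \<le> 1 / \<beta> * real (card (m u))" if "u \<in> N" for u
        using good_card_ge[OF g', of u] that beta by simp
      moreover have "finite (\<l> v)" "\<l> v \<noteq> {}" using goodD(2)[OF g v] good_list_nonempty[OF g v] by auto
      ultimately show ?thesis
        using star_count_ge[of N m "1 / \<beta>" "\<l> v"] N(1,2) fin beta
        by (simp add: num_eq a_def z_def P_def)
    qed
    moreover have "num E (m(v := m v \<inter> {j})) (insert v N) \<le> P"
    proof -
      have "num E (m(v := m v \<inter> {j})) (insert v N)
          = (\<Sum>k\<in>m v \<inter> {j}. \<Prod>u\<in>N. real (card (m u - {k})))"
        using num_update[OF sym irrefl, of v "insert v N" m "m v \<inter> {j}"] N fin by (simp add: num_i)
      also have "\<dots> \<le> (\<Sum>k\<in>{j}. \<Prod>u\<in>N. real (card (m u - {k})))"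
        by (intro sum_mono2) (auto intro: prod_nonneg)
      also have "\<dots> \<le> P"
        unfolding P_def using fin by (auto intro!: prod_mono card_mono)
      finally show ?thesis .
    qed
    moreover have "0 < a * exp (- z)" using a a0 by simp
    ultimately have "num E (m(v := m v \<inter> {j})) (insert v N) * (a * exp (- z)) \<le> num E m (insert v N)"
      by (smt (verit) mult.commute mult_right_mono)
    then have "prob E m (insert v N) v j \<le> 1 / (a * exp (- z))"
      using num_pos[OF g'] \<open>0 < a * exp (- z)\<close> by (simp add: prob_def field_simps)
    then show "prob E m (S - (S - {v} - N)) v j \<le> 1 / (a * exp (- z))" by (simp only: eq)
  qed auto
  \<comment> \<open>Both factors of \<open>a * exp (- z)\<close> grow with \<open>a\<close>, so
    \<open>a\<close> may be replaced by its lower bound \<open>\<alpha> * deg E S v\<close>; the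
    degree then cancels in the exponent.\<close>
  also have "\<dots> \<le> 1 / (\<alpha> * deg E S v * exp (- (1 / \<alpha>) * (1 + 1 / \<beta>)))"
  proof (intro divide_left_mono mult_mono)
    have "z \<le> (1 + 1 / \<beta>) * deg E S v / (\<alpha> * deg E S v)"
      unfolding z_def using a a0 beta by (intro divide_left_mono mult_nonneg_nonneg) auto
    then show "exp (- (1 / \<alpha>) * (1 + 1 / \<beta>)) \<le> exp (- z)"
      using False by simp
  qed (use a a0 in auto)
  finally have "prob E \<l> S v j * deg E S v
      \<le> 1 / (\<alpha> * deg E S v * exp (- (1 / \<alpha>) * (1 + 1 / \<beta>))) * deg E S v"
    by (rule mult_right_mono) simp
  then show ?thesis using False by simp
qed

end

section \<open>Contraction\<close>

definition avg :: "'v rel \<Rightarrow> ('v \<Rightarrow> nat set) \<Rightarrow> 'v set \<Rightarrow> (('v \<Rightarrow> nat option) \<Rightarrow> real) \<Rightarrow> real" where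
  "avg E \<l> S g = (\<Sum>c\<in>colorings E \<l> S. g c) / num E \<l> S"

context list_coloring_setup
begin

text \<open>The reciprocal of the quantity that the theorem assumes to exceed 1.\<close>

definition \<rho> :: real where
  "\<rho> = 1 / ((1 - 1 / \<beta>) * (\<alpha> * exp (- (1 / \<alpha>) * (1 + 1 / \<beta>))))"

text \<open>Every \<open>ln (1 - prob E \<l> S v i)\<close> lies between \<open>- K / 2\<close> and
  0, so a difference of two differences of such terms is at most \<open>K\<close>.\<close>

definition K :: real where
  "K = - 2 * ln (1 - 1 / \<beta>)"

lemma rho_pos: "0 < \<rho>"
  using alpha beta by (simp add: \<rho>_def)

lemma K_nonneg: "0 \<le> K"
  using beta by (simp add: K_def)

text \<open>Walks are used instead of distances, so that prepending an edge needs no argument about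
  shortest paths. For \<open>n = 0\<close> the condition is empty, and \<open>n = 1\<close> concerns
  \<open>v\<close> alone.\<close>

definition agree :: "nat \<Rightarrow> 'v \<Rightarrow> 'v set \<Rightarrow> ('v \<Rightarrow> nat set) \<Rightarrow> ('v \<Rightarrow> nat set) \<Rightarrow> bool" where
  "agree n v S \<l> \<l>' \<longleftrightarrow> (\<forall>k<n. \<forall>u\<in>S. (v, u) \<in> E ^^ k \<longrightarrow> \<l> u = \<l>' u)"

lemma agree_Suc_self: "agree (Suc n) v S \<l> \<l>' \<Longrightarrow> v \<in> S \<Longrightarrow> \<l> v = \<l>' v"
  unfolding agree_def by (metis relpow_0_I zero_less_Suc)

text \<open>\<open>i\<close> and \<open>j\<close> range over all colors: they will be colors of a
  neighbor of \<open>v\<close> and need not occur in the list of \<open>v\<close>.\<close>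

definition avoidance_osc_le :: "nat \<Rightarrow> real \<Rightarrow> bool" where
  "avoidance_osc_le n b \<longleftrightarrow> (\<forall>S \<l> \<l>' v i j. good \<l> S \<longrightarrow> good \<l>' S \<longrightarrow> v \<in> S \<longrightarrow> agree n v S \<l> \<l>' \<longrightarrow>
     ln (1 - prob E \<l> S v i) - ln (1 - prob E \<l>' S v i)
       - (ln (1 - prob E \<l> S v j) - ln (1 - prob E \<l>' S v j)) \<le> b)"

text \<open>To compare the numbers of colorings with \<open>v\<close> colored \<open>i\<close> and \<open>j\<close>, the neighbors of \<open>v\<close> are
  switched one at a time from avoiding \<open>j\<close> to avoiding \<open>i\<close>. In each step both numbers are expressed
  by the same distribution, the one in which the list of the switched neighbor is unrestricted. This
  is what saves a factor \<open>2\<close> in the contraction.\<close>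

lemma num_forbid_osc_le:
  assumes b: "avoidance_osc_le n b"
    and g: "good \<l> S" "good \<l>' S" and v: "v \<in> S" and agree: "agree (Suc n) v S \<l> \<l>'"
  shows "ln (num E (forbid E v i \<l>) (S - {v})) - ln (num E (forbid E v i \<l>') (S - {v}))
    - (ln (num E (forbid E v j \<l>) (S - {v})) - ln (num E (forbid E v j \<l>') (S - {v})))
    \<le> b * deg E S v"
proof -
  define T where "T = S - {v}"
  define N where "N = S \<inter> E `` {v}"
  \<comment> \<open>The neighbors in \<open>A\<close> already avoid \<open>i\<close>, the others
    still avoid \<open>j\<close>; on \<open>T\<close>, the extremes \<open>A = {}\<close> and
    \<open>A = N\<close> are the two counts to be compared.\<close>
  define mix where "mix A \<l> = (\<lambda>u. if u \<in> A then \<l> u - {i} else forbid E v j \<l> u)" for A and \<l> :: "'v \<Rightarrow> nat set"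
  define F where "F A = ln (num E (mix A \<l>) T) - ln (num E (mix A \<l>') T)" for A
  have "finite N" using goodD(1)[OF g(1)] by (simp add: N_def)
  moreover have "A \<subseteq> N \<Longrightarrow> F A - F {} \<le> b * card A" if "finite A" for A
    using that
  proof (induction A rule: finite_induct)
    case empty
    then show ?case by simp
  next
    case (insert u A)
    have u: "u \<in> T" "(v, u) \<in> E" "u \<in> S" using insert.prems irreflE by (auto simp: T_def N_def)
    have NE: "(v, w) \<in> E" if "w \<in> A" for w using insert.prems that by (auto simp: N_def)
    define m where "m \<l> = (mix A \<l>)(u := \<l> u)" for \<l>
    have good_m: "good (m l) T" if "good l S" for l
      unfolding T_def
    proof (rule good_Diff[OF that v])
      fix w assume "w \<in> S - {v}"
      then have "finite (l w)" using goodD(2)[OF that] by blast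
      then show "finite (m l w)" "card (l w) \<le> card (m l w) + (if (v, w) \<in> E then 1 else 0)"
        using NE by (auto simp: m_def mix_def forbid_def card_Diff_singleton_if)
    qed
    \<comment> \<open>Both counts equal \<open>num E (m l) T\<close> times the probability that
      \<open>u\<close> avoids a color, so the common total cancels.\<close>
    have step: "ln (num E (mix (insert u A) l) T) - ln (num E (mix A l) T)
        = ln (1 - prob E (m l) T u i) - ln (1 - prob E (m l) T u j)" if "good l S" for l
    proof -
      have m: "good (m l) T" using good_m[OF that] .
      have *: "num E ((m l)(u := m l u - {k})) T = num E (m l) T * (1 - prob E (m l) T u k)" for k
        using num_update_Diff[OF sym irrefl u(1) goodD(1)[OF m]] goodD(2)[OF m] num_pos[OF m] by blast
      have "mix (insert u A) l = (m l)(u := m l u - {i})" "mix A l = (m l)(u := m l u - {j})"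
        using u insert.hyps by (auto simp: m_def mix_def forbid_def fun_eq_iff)
      moreover have "prob E (m l) T u k \<noteq> 1" for k
        using prob_le_inverse_beta[OF m u(1), of k] beta by (smt (verit) divide_less_eq_1_pos)
      ultimately show ?thesis using num_pos[OF m] by (simp add: * ln_mult)
    qed
    \<comment> \<open>The edge from \<open>v\<close> to \<open>u\<close> uses up one of the
      \<open>Suc n\<close> levels of agreement.\<close>
    have "agree n u T (m \<l>) (m \<l>')"
      unfolding agree_def
    proof (intro allI impI ballI)
      fix k w assume "k < n" "w \<in> T" "(u, w) \<in> E ^^ k"
      then have "(v, w) \<in> E ^^ Suc k" using u(2) by (blast intro: relpow_Suc_I2)
      then have "\<l> w = \<l>' w" using agree \<open>k < n\<close> \<open>w \<in> T\<close> unfolding agree_def T_def by blast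
      then show "m \<l> w = m \<l>' w" by (auto simp: m_def mix_def forbid_def)
    qed
    then have "F (insert u A) - F A \<le> b"
      using b good_m[OF g(1)] good_m[OF g(2)] u(1) step[OF g(1)] step[OF g(2)]
      unfolding avoidance_osc_le_def F_def by (smt (verit))
    moreover have "F A - F {} \<le> b * card A" using insert by simp
    ultimately show ?case using insert.hyps by (simp add: algebra_simps)
  qed
  ultimately have "F N - F {} \<le> b * card N" by blast
  moreover have "num E (mix N l) T = num E (forbid E v i l) T" for l
    by (rule num_cong) (auto simp: mix_def forbid_def N_def T_def)
  moreover have "mix {} l = forbid E v j l" for l
    by (simp add: mix_def)
  ultimately show ?thesis by (simp add: F_def T_def N_def deg_def)
qed

lemma ln_prob:
  assumes "good \<l> S" "v \<in> S" "i \<in> \<l> v"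
  shows "ln (prob E \<l> S v i) = ln (num E (forbid E v i \<l>) (S - {v})) - ln (num E \<l> S)"
  using assms num_pos[OF good_forbid[OF assms(1,2)], of i] num_pos[OF assms(1)]
  by (simp add: prob_good ln_div)

text \<open>The normalizing counts \<open>num E \<l> S\<close> and \<open>num E \<l>' S\<close> do
  not depend on the color and cancel between \<open>i\<close> and \<open>j\<close>.\<close>

lemma prob_osc_le:
  assumes "avoidance_osc_le n b" "good \<l> S" "good \<l>' S" "v \<in> S" "agree (Suc n) v S \<l> \<l>'"
    and "i \<in> \<l> v" "j \<in> \<l> v"
  shows "ln (prob E \<l> S v i) - ln (prob E \<l>' S v i) - (ln (prob E \<l> S v j) - ln (prob E \<l>' S v j))
    \<le> b * deg E S v"
proof -
  have "i \<in> \<l>' v" "j \<in> \<l>' v" using assms agree_Suc_self by blast+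
  then show ?thesis
    using num_forbid_osc_le[OF assms(1-5), of i j] assms by (simp add: ln_prob)
qed

text \<open>In the induction step \<open>prob_osc_le\<close> costs a factor \<open>d\<close>, the
  degree of \<open>v\<close> in \<open>S\<close>, and \<open>ln_one_minus_contraction\<close>
  returns \<open>\<rho> / d\<close>.\<close>

lemma avoidance_osc_le_power: "avoidance_osc_le n (K * \<rho> ^ n)"
proof (induction n)
  case 0
  have "K / - 2 \<le> ln (1 - prob E \<l> S v i)" "ln (1 - prob E \<l> S v i) \<le> 0" if "good \<l> S" "v \<in> S" for \<l> S v i
  proof -
    have p: "0 \<le> prob E \<l> S v i" "prob E \<l> S v i \<le> 1 / \<beta>"
      using prob_le_inverse_beta[OF that] by (auto simp: prob_def)
    moreover have "1 / \<beta> < 1" using beta by simp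
    ultimately have "prob E \<l> S v i < 1" by linarith
    then show "ln (1 - prob E \<l> S v i) \<le> 0" using p by simp
    have "ln (1 - 1 / \<beta>) \<le> ln (1 - prob E \<l> S v i)"
      using p \<open>1 / \<beta> < 1\<close> by (intro ln_mono) auto
    then show "K / - 2 \<le> ln (1 - prob E \<l> S v i)" by (simp add: K_def)
  qed
  note bounds = this
  show ?case
    unfolding avoidance_osc_le_def
  proof (intro allI impI)
    fix S \<l> \<l>' v i j
    assume "good \<l> S" "good \<l>' S" "v \<in> S"
    then show "ln (1 - prob E \<l> S v i) - ln (1 - prob E \<l>' S v i)
        - (ln (1 - prob E \<l> S v j) - ln (1 - prob E \<l>' S v j)) \<le> K * \<rho> ^ 0"
      using bounds[of \<l> S v i] bounds[of \<l> S v j] bounds[of \<l>' S v i] bounds[of \<l>' S v j] by simp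
  qed
next
  case (Suc n)
  show ?case unfolding avoidance_osc_le_def
  proof (intro allI impI)
    fix S \<l> \<l>' v i j
    assume g: "good \<l> S" "good \<l>' S" and v: "v \<in> S" and agree: "agree (Suc n) v S \<l> \<l>'"
    have eq: "\<l> v = \<l>' v" using agree v by (rule agree_Suc_self)
    define d where "d = real (deg E S v)"
    \<comment> \<open>For \<open>d = 0\<close> the oscillation bound is already 0, and
      \<open>s = 1\<close> is admissible because marginals are at most \<open>1 / 2\<close>.\<close>
    define s where "s = (if d = 0 then 1 else \<rho> / d)"
    have d: "0 \<le> d" by (simp add: d_def)
    have lt: "prob E l S v k \<le> 1 / 2" if "good l S" for l k
      using prob_le_inverse_beta[OF that v, of k] beta by (smt (verit) frac_le)
    have s: "prob E l S v k \<le> s * (1 - prob E l S v k)" if l: "good l S" for l k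
    proof (cases "d = 0")
      case True
      then show ?thesis using lt[OF l, of k] by (simp add: s_def)
    next
      case False
      have "prob E l S v k * d \<le> 1 / (\<alpha> * exp (- (1 / \<alpha>) * (1 + 1 / \<beta>)))"
        unfolding d_def using l v by (rule prob_deg_le)
      also have "\<dots> = \<rho> * (1 - 1 / \<beta>)"
        using beta by (simp add: \<rho>_def)
      also have "\<dots> \<le> \<rho> * (1 - prob E l S v k)"
        using prob_le_inverse_beta[OF l v, of k] rho_pos by (intro mult_left_mono) auto
      finally show ?thesis using False d by (simp add: s_def field_simps)
    qed
    have "ln (1 - prob E \<l> S v i) - ln (1 - prob E \<l>' S v i)
       - (ln (1 - prob E \<l> S v j) - ln (1 - prob E \<l>' S v j)) \<le> s * (K * \<rho> ^ n * d)"
    proof (rule ln_one_minus_contraction[where A = "\<l> v"])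
      show "finite (\<l> v)" using goodD(2)[OF g(1) v] .
      show "(\<Sum>k\<in>\<l> v. prob E \<l> S v k) = (\<Sum>k\<in>\<l> v. prob E \<l>' S v k)"
        using sum_prob[OF g(1) v] sum_prob[OF g(2) v] eq by simp
      show "0 \<le> s" using rho_pos d by (simp add: s_def)
      show "prob E \<l> S v k < 1" "prob E \<l>' S v k < 1" for k
        using lt[OF g(1), of k] lt[OF g(2), of k] by auto
      show "ln (prob E \<l> S v i) - ln (prob E \<l>' S v i) - (ln (prob E \<l> S v j) - ln (prob E \<l>' S v j))
          \<le> K * \<rho> ^ n * d" if "i \<in> \<l> v" "j \<in> \<l> v" for i j
        unfolding d_def using prob_osc_le[OF Suc.IH g v agree that] .
      show "prob E \<l> S v k = 0" "prob E \<l>' S v k = 0" if "k \<notin> \<l> v" for k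
        using that g v eq by (simp_all add: prob_good)
    qed (use g v eq s prob_pos K_nonneg rho_pos d in auto)
    also have "\<dots> \<le> K * \<rho> ^ Suc n"
      using K_nonneg rho_pos by (simp add: s_def)
    finally show "ln (1 - prob E \<l> S v i) - ln (1 - prob E \<l>' S v i)
       - (ln (1 - prob E \<l> S v j) - ln (1 - prob E \<l>' S v j)) \<le> K * \<rho> ^ Suc n" .
  qed
qed

text \<open>The exponent is \<open>n\<close>, not \<open>Suc n\<close>: the last step, from the
  neighbors to \<open>v\<close>, costs the degree and gains no factor \<open>\<rho>\<close>.\<close>

lemma sum_prob_diff_le:
  assumes "good \<l> S" "good \<l>' S" "v \<in> S" "agree (Suc n) v S \<l> \<l>'"
  shows "(\<Sum>k\<in>\<l> v. \<bar>prob E \<l> S v k - prob E \<l>' S v k\<bar>) \<le> 2 * (K * \<rho> ^ n * deg E S v)"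
proof -
  have eq: "\<l> v = \<l>' v" using assms agree_Suc_self by blast
  show ?thesis
    using assms eq sum_prob[of \<l> S v] sum_prob[of \<l>' S v]
    by (intro sum_abs_diff_le_ln_osc prob_osc_le[OF avoidance_osc_le_power]) (auto dest: goodD(2) intro: prob_pos)
qed

section \<open>From one vertex to the set \<open>\<Lambda>\<close>\<close>

lemma avg_split:
  assumes g: "good \<l> S" and v: "v \<in> S"
  shows "avg E \<l> S f = (\<Sum>k\<in>\<l> v. prob E \<l> S v k * avg E (forbid E v k \<l>) (S - {v}) (\<lambda>c. f (c(v \<mapsto> k))))"
proof -
  have "num E (forbid E v k \<l>) (S - {v}) \<noteq> 0" for k
    using num_pos[OF good_forbid[OF g v], of k] by simp
  then show ?thesis
    using sum_colorings[OF sym irrefl v, of \<l> f] goodD[OF g] v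
    by (simp add: avg_def prob_good[OF g v] sum_divide_distrib[of _ "\<l> v"])
qed

lemma abs_avg_le:
  assumes "good \<l> S" "\<And>c. \<bar>f c\<bar> \<le> 1"
  shows "\<bar>avg E \<l> S f\<bar> \<le> 1"
proof -
  have "\<bar>\<Sum>c\<in>colorings E \<l> S. f c\<bar> \<le> (\<Sum>c\<in>colorings E \<l> S. 1)"
    using assms(2) by (intro order_trans[OF sum_abs] sum_mono)
  then show ?thesis using num_pos[OF assms(1)] by (simp add: avg_def num_def)
qed

text \<open>The vertices of \<open>\<Lambda>\<close> are revealed one by one, each at the cost of
  the bound for a single marginal. Giving \<open>v\<close> the same color \<open>k\<close> on both
  sides preserves agreement near the other vertices. The test function is arbitrary because the
  color of \<open>v\<close> is absorbed into it.\<close>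

lemma avg_restrict_diff_le:
  assumes "finite \<Lambda>" "\<Lambda> \<subseteq> S" "good \<l> S" "good \<l>' S" "\<And>c. \<bar>f c\<bar> \<le> 1"
    and "\<And>v. v \<in> \<Lambda> \<Longrightarrow> agree (Suc n) v S \<l> \<l>'" "\<And>v. v \<in> \<Lambda> \<Longrightarrow> deg E S v \<le> D"
  shows "\<bar>avg E \<l> S (\<lambda>c. f (c |` \<Lambda>)) - avg E \<l>' S (\<lambda>c. f (c |` \<Lambda>))\<bar> \<le> card \<Lambda> * (2 * (K * \<rho> ^ n * D))"
  using assms
proof (induction \<Lambda> arbitrary: S \<l> \<l>' f rule: finite_induct)
  case empty
  then show ?case using num_pos[of \<l> S] num_pos[of \<l>' S] by (simp add: avg_def num_def)
next
  case (insert v \<Lambda>)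
  note g = insert.prems(2,3)
  have v: "v \<in> S" using insert.prems by simp
  have agree: "agree (Suc n) v S \<l> \<l>'" using insert.prems by simp
  have eq: "\<l> v = \<l>' v" using agree v by (rule agree_Suc_self)
  define \<epsilon> where "\<epsilon> = 2 * (K * \<rho> ^ n * D)"
  define h where "h = (\<lambda>k c. f ((c |` \<Lambda>)(v \<mapsto> k)))"
  define e where "e k = avg E (forbid E v k \<l>) (S - {v}) (h k)" for k
  define e' where "e' k = avg E (forbid E v k \<l>') (S - {v}) (h k)" for k
  have \<Lambda>: "\<Lambda> - {v} = \<Lambda>" using insert.hyps by simp
  have avg: "avg E \<l> S (\<lambda>c. f (c |` insert v \<Lambda>)) = (\<Sum>k\<in>\<l> v. prob E \<l> S v k * e k)"
    "avg E \<l>' S (\<lambda>c. f (c |` insert v \<Lambda>)) = (\<Sum>k\<in>\<l> v. prob E \<l>' S v k * e' k)"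
    using g v by (simp_all add: avg_split \<Lambda> e_def e'_def h_def eq)
  have gf: "good (forbid E v k \<l>) (S - {v})" "good (forbid E v k \<l>') (S - {v})" for k
    using g v by (auto intro: good_forbid)
  have ee: "\<bar>e k - e' k\<bar> \<le> card \<Lambda> * \<epsilon>" for k
    unfolding e_def e'_def h_def \<epsilon>_def
  proof (rule insert.IH[OF _ gf])
    fix w assume w: "w \<in> \<Lambda>"
    then have "agree (Suc n) w S \<l> \<l>'" using insert.prems by simp
    then show "agree (Suc n) w (S - {v}) (forbid E v k \<l>) (forbid E v k \<l>')"
      by (simp add: agree_def forbid_def)
    have "deg E (S - {v}) w \<le> deg E S w"
      unfolding deg_def using goodD(1)[OF g(1)] by (intro card_mono) auto
    then show "deg E (S - {v}) w \<le> D" using insert.prems(6)[of w] w by simp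
  qed (use insert in auto)
  have e1: "\<bar>e' k\<bar> \<le> 1" for k
    unfolding e'_def h_def using gf insert.prems(4) by (intro abs_avg_le)
  \<comment> \<open>The difference of products splits into \<open>p * (e - e')\<close>, handled by
    induction, and \<open>(p - p') * e'\<close>, handled by the marginal at
    \<open>v\<close>.\<close>
  have "\<bar>avg E \<l> S (\<lambda>c. f (c |` insert v \<Lambda>)) - avg E \<l>' S (\<lambda>c. f (c |` insert v \<Lambda>))\<bar>
      = \<bar>\<Sum>k\<in>\<l> v. prob E \<l> S v k * (e k - e' k) + (prob E \<l> S v k - prob E \<l>' S v k) * e' k\<bar>"
    unfolding avg sum_subtractf[symmetric] by (simp add: algebra_simps)
  also have "\<dots> \<le> (\<Sum>k\<in>\<l> v. prob E \<l> S v k * (card \<Lambda> * \<epsilon>) + \<bar>prob E \<l> S v k - prob E \<l>' S v k\<bar>)"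
  proof (intro order_trans[OF sum_abs] sum_mono)
    fix k assume "k \<in> \<l> v"
    have "0 \<le> prob E \<l> S v k" by (simp add: prob_def)
    then have "\<bar>prob E \<l> S v k * (e k - e' k)\<bar> \<le> prob E \<l> S v k * (card \<Lambda> * \<epsilon>)"
      using ee[of k] by (simp add: abs_mult mult_left_mono)
    moreover have "\<bar>(prob E \<l> S v k - prob E \<l>' S v k) * e' k\<bar> \<le> \<bar>prob E \<l> S v k - prob E \<l>' S v k\<bar>"
      using e1[of k] by (simp add: abs_mult mult_left_le)
    ultimately show "\<bar>prob E \<l> S v k * (e k - e' k) + (prob E \<l> S v k - prob E \<l>' S v k) * e' k\<bar>
        \<le> prob E \<l> S v k * (card \<Lambda> * \<epsilon>) + \<bar>prob E \<l> S v k - prob E \<l>' S v k\<bar>"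
      by linarith
  qed
  also have "\<dots> = card \<Lambda> * \<epsilon> + (\<Sum>k\<in>\<l> v. \<bar>prob E \<l> S v k - prob E \<l>' S v k\<bar>)"
    using sum_prob[OF g(1) v] by (simp add: sum.distrib flip: sum_distrib_right)
  also have "\<dots> \<le> card \<Lambda> * \<epsilon> + 2 * (K * \<rho> ^ n * deg E S v)"
    using sum_prob_diff_le[OF g v agree] by simp
  also have "\<dots> \<le> card \<Lambda> * \<epsilon> + \<epsilon>"
    unfolding \<epsilon>_def using insert.prems(6)[of v] K_nonneg rho_pos
    by (intro add_left_mono mult_left_mono) auto
  finally show ?case using insert.hyps by (simp add: \<epsilon>_def algebra_simps)
qed

end

section \<open>Strong spatial mixing\<close>

text \<open>The sign of the difference of the two mass functions is the optimal test function;
  without the factor \<open>1/2\<close> it attains the distance exactly.\<close>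

lemma tv_dist_eq_expectation:
  fixes p q :: "'a pmf"
  assumes "finite A" "set_pmf p \<subseteq> A" "set_pmf q \<subseteq> A"
  shows "\<exists>f. (\<forall>x. \<bar>f x\<bar> \<le> 1) \<and>
    tv_dist p q = measure_pmf.expectation p f - measure_pmf.expectation q f"
proof -
  define f where "f x = sgn (pmf p x - pmf q x)" for x
  have f: "\<bar>f x\<bar> \<le> 1" for x by (simp add: f_def sgn_real_def)
  have "pmf p x = 0" "pmf q x = 0" if "x \<notin> A" for x
    using assms that by (auto simp: pmf_eq_0_set_pmf)
  then have "tv_dist p q = (\<Sum>\<^sub>\<infinity>x\<in>A. \<bar>pmf p x - pmf q x\<bar>)"
    unfolding tv_dist_def by (intro infsum_cong_neutral) auto
  also have "\<dots> = (\<Sum>x\<in>A. f x * pmf p x - f x * pmf q x)"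
    using assms(1) by (simp add: f_def abs_sgn left_diff_distrib mult.commute)
  also have "\<dots> = measure_pmf.expectation p f - measure_pmf.expectation q f"
    using assms by (subst (1 2) integral_measure_pmf_real[of A]) (auto simp: sum_subtractf)
  finally have "tv_dist p q = measure_pmf.expectation p f - measure_pmf.expectation q f" .
  with f show ?thesis by blast
qed

section \<open>Boundary conditions turned into lists\<close>

definition residual_lists ::
  "'v rel \<Rightarrow> ('v \<Rightarrow> nat set) \<Rightarrow> ('v \<Rightarrow> nat option) \<Rightarrow> 'v \<Rightarrow> nat set" where
  "residual_lists E L C = (\<lambda>u. L u - {k. \<exists>w. (u, w) \<in> E \<and> C w = Some k})"

lemma compatible_colorings_eq: "compatible_colorings E L \<Psi> C = colorings E (residual_lists E L C) \<Psi>"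
proof (intro set_eqI iffI)
  fix c assume c: "c \<in> compatible_colorings E L \<Psi> C"
  then show "c \<in> colorings E (residual_lists E L C) \<Psi>"
    unfolding compatible_colorings_def colorings_def list_coloring_def residual_lists_def
    by (auto simp: dom_def)  (metis option.sel)+
next
  fix c assume "c \<in> colorings E (residual_lists E L C) \<Psi>"
  then show "c \<in> compatible_colorings E L \<Psi> C"
    unfolding compatible_colorings_def colorings_def list_coloring_def residual_lists_def
    by (auto simp: dom_def) (metis option.sel)+
qed

lemma expectation_marginal_cond_dist:
  assumes "finite (colorings E (residual_lists E L C) \<Psi>)" "colorings E (residual_lists E L C) \<Psi> \<noteq> {}"
  shows "measure_pmf.expectation (marginal \<Lambda> (cond_dist E L \<Psi> C)) f
    = avg E (residual_lists E L C) \<Psi> (\<lambda>c. f (c |` \<Lambda>))"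
  using assms
  by (simp add: marginal_def cond_dist_def compatible_colorings_eq avg_def num_def integral_pmf_of_set)

lemma set_dist_le:
  assumes "v \<in> A" "w \<in> B" "(v, w) \<in> E ^^ n"
  shows "set_dist E A B \<le> enat n"
proof -
  have "set_dist E A B \<le> (INF w\<in>B. graph_dist E v w)"
    unfolding set_dist_def using assms(1) by (rule INF_lower)
  also have "\<dots> \<le> graph_dist E v w"
    using assms(2) by (rule INF_lower)
  also have "\<dots> \<le> enat n"
    unfolding graph_dist_def using assms(3) by (intro INF_lower) simp
  finally show ?thesis .
qed

context list_coloring_setup
begin

text \<open>The residual list at \<open>u\<close> depends on the boundary colors one edge beyond
  \<open>u\<close>, so distance \<open>Suc n\<close> gives agreement only at level
  \<open>n\<close>.\<close>

lemma agree_residual_lists: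
  assumes "{u. C\<^sub>1 u \<noteq> C\<^sub>2 u} \<subseteq> W" "v \<in> \<Lambda>" "enat (Suc n) \<le> set_dist E \<Lambda> W"
  shows "agree n v \<Psi> (residual_lists E L C\<^sub>1) (residual_lists E L C\<^sub>2)"
  unfolding agree_def
proof (intro allI ballI impI)
  fix k u assume k: "k < n" "(v, u) \<in> E ^^ k"
  have "C\<^sub>1 w = C\<^sub>2 w" if "(u, w) \<in> E" for w
  proof (rule ccontr)
    assume "C\<^sub>1 w \<noteq> C\<^sub>2 w"
    then have "w \<in> W" using assms(1) by blast
    moreover have "(v, w) \<in> E ^^ Suc k" using k(2) that by auto
    ultimately have "set_dist E \<Lambda> W \<le> enat (Suc k)" using assms(2) set_dist_le by metis
    then have "enat (Suc n) \<le> enat (Suc k)" using assms(3) order_trans by blast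
    then show False using k(1) by simp
  qed
  then show "residual_lists E L C\<^sub>1 u = residual_lists E L C\<^sub>2 u"
    by (auto simp: residual_lists_def)
qed

text \<open>Each neighbor outside \<open>\<Psi>\<close> removes at most one color and is not counted
  in \<open>deg E \<Psi> u\<close>; as \<open>\<alpha> \<ge> 1\<close>, the inequality
  survives.\<close>

lemma good_residual_lists:
  assumes \<Psi>: "finite \<Psi>" "dom C \<inter> \<Psi> = {}"
    and L: "\<And>v. v \<in> \<Psi> \<Longrightarrow> finite (L v)" "\<And>v. v \<in> \<Psi> \<Longrightarrow> \<alpha> * vertex_degree E v + \<beta> \<le> card (L v)"
    and E: "\<And>v. v \<in> \<Psi> \<Longrightarrow> finite (E `` {v})"
  shows "good (residual_lists E L C) \<Psi>"
  unfolding good_def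
proof (intro conjI ballI)
  fix u assume u: "u \<in> \<Psi>"
  define X where "X = {k. \<exists>w. (u, w) \<in> E \<and> C w = Some k}"
  have "X \<subseteq> (\<lambda>w. the (C w)) ` (E `` {u} - \<Psi>)"
    using \<Psi>(2) by (force simp: X_def)
  then have X: "finite X" "card X \<le> card (E `` {u} - \<Psi>)"
    using E[OF u] by (meson finite_Diff finite_imageI finite_subset surj_card_le)+
  have "vertex_degree E u = deg E \<Psi> u + card (E `` {u} - \<Psi>)"
    using card_Int_Diff[OF E[OF u], of \<Psi>] by (simp add: vertex_degree_def deg_def Int_commute)
  then have "\<alpha> * vertex_degree E u = \<alpha> * deg E \<Psi> u + \<alpha> * card (E `` {u} - \<Psi>)"
    by (simp add: algebra_simps)
  moreover have "card (E `` {u} - \<Psi>) \<le> \<alpha> * card (E `` {u} - \<Psi>)"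
    using mult_right_mono[OF alpha, of "card (E `` {u} - \<Psi>)"] by simp
  moreover have "card (L u) - card X \<le> card (L u - X)"
    using X(1) by (rule diff_card_le_card_Diff)
  ultimately show "\<alpha> * real (deg E \<Psi> u) + \<beta> \<le> real (card (residual_lists E L C u))"
    using L(2)[OF u] X(2) unfolding residual_lists_def X_def by linarith
  show "finite (residual_lists E L C u)" using L(1)[OF u] by (simp add: residual_lists_def)
qed (rule \<Psi>)

lemma colorings_nonempty: "good \<l> S \<Longrightarrow> finite (colorings E \<l> S) \<and> colorings E \<l> S \<noteq> {}"
  using num_pos[of \<l> S] by (auto simp: num_def card_gt_0_iff)

end

theorem theorem1:
  fixes V :: "'v set" and E :: "'v rel" and \<Delta> q :: nat
    and L :: "'v \<Rightarrow> nat set" and \<alpha> \<beta> :: real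
  assumes "simple_graph V E" and "infinite V" and "triangle_free E"
    and "has_max_degree V E \<Delta>"
    and "\<And>v. v \<in> V \<Longrightarrow> L v \<subseteq> {1..q}"
    and "\<alpha> > alpha_star"
    and "\<beta> \<ge> sqrt 2 / (sqrt 2 - 1)"
    and "(1 - 1 / \<beta>) * \<alpha> * exp (- (1 / \<alpha>) * (1 + 1 / \<beta>)) > 1"
    and "\<And>v. v \<in> V \<Longrightarrow> real (card (L v)) \<ge> \<alpha> * real (vertex_degree E v) + \<beta>"
  shows "strong_spatial_mixing V E L"
proof -
  \<comment> \<open>The constant \<open>sqrt 2 / (sqrt 2 - 1)\<close> equals
    \<open>2 + sqrt 2\<close>.\<close>
  have \<beta>: "2 \<le> \<beta>"
  proof -
    have "1 < sqrt (2::real)" "sqrt (2::real) \<le> 2" by (auto intro: real_le_lsqrt)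
    then have "2 \<le> sqrt 2 / (sqrt 2 - (1::real))" by (simp add: le_divide_eq)
    then show ?thesis using assms(7) by linarith
  qed
  have \<alpha>: "1 \<le> \<alpha>"
  proof -
    have "0 < 1 - 1 / \<beta>" "1 - 1 / \<beta> \<le> 1" using \<beta> by auto
    \<comment> \<open>Positivity comes first, since only then is the exponential factor at most 1;
      \<open>\<alpha>\<close> must then exceed 1, as the other factors cannot raise it.\<close>
    have "0 < \<alpha>"
    proof (rule ccontr)
      assume "\<not> 0 < \<alpha>"
      then have "(1 - 1 / \<beta>) * \<alpha> * exp (- (1 / \<alpha>) * (1 + 1 / \<beta>)) \<le> 0"
        using \<open>0 < 1 - 1 / \<beta>\<close> by (intro mult_nonpos_nonneg mult_nonneg_nonpos) auto
      then show False using assms(8) by simp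
    qed
    then have "exp (- (1 / \<alpha>) * (1 + 1 / \<beta>)) \<le> 1" using \<beta> by simp
    then have "(1 - 1 / \<beta>) * \<alpha> * exp (- (1 / \<alpha>) * (1 + 1 / \<beta>)) \<le> 1 * \<alpha> * 1"
      using \<open>0 < \<alpha>\<close> \<open>1 - 1 / \<beta> \<le> 1\<close> \<open>0 < 1 - 1 / \<beta>\<close> by (intro mult_mono) auto
    then show ?thesis using assms(8) by simp
  qed
  interpret list_coloring_setup E \<alpha> \<beta>
    using assms(1,3) \<alpha> \<beta> by unfold_locales (auto simp: simple_graph_def)
  have rho: "0 < \<rho>" "\<rho> < 1"
    using rho_pos assms(8) by (auto simp: \<rho>_def mult.assoc divide_less_eq_1)
  define M where "M = 2 * (K * \<Delta>)"
  have M: "0 \<le> M" using K_nonneg by (simp add: M_def)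
  \<comment> \<open>\<open>2 / \<rho>\<close> serves distances up to 1. From distance 2 on,
    \<open>M / \<rho>\<^sup>2\<close> makes up for two lost steps, one in
    \<open>agree_residual_lists\<close> and one in \<open>sum_prob_diff_le\<close>.\<close>
  define A where "A = 2 / \<rho> + M / \<rho>\<^sup>2"
  define \<theta> where "\<theta> = - ln \<rho>"
  have exp_theta: "exp_decay \<theta> (enat n) = \<rho> ^ n" for n
    using rho by (simp add: exp_decay_def \<theta>_def exp_of_nat2_mult)
  show ?thesis unfolding strong_spatial_mixing_def
  proof (rule exI[of _ A], rule exI[of _ \<theta>], intro conjI allI impI)
    show "0 < A" "0 < \<theta>" using rho M by (auto simp: A_def \<theta>_def add_pos_nonneg)
    fix \<Psi> C\<^sub>1 C\<^sub>2 W \<Lambda>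
    assume \<Psi>: "finite \<Psi>" "\<Psi> \<subseteq> V" and C: "free_coloring E L (V - \<Psi>) C\<^sub>1" "free_coloring E L (V - \<Psi>) C\<^sub>2"
      and W: "{u. C\<^sub>1 u \<noteq> C\<^sub>2 u} \<subseteq> W" and \<Lambda>: "\<Lambda> \<subseteq> \<Psi>"
    let ?l1 = "residual_lists E L C\<^sub>1" and ?l2 = "residual_lists E L C\<^sub>2"
    let ?p1 = "marginal \<Lambda> (cond_dist E L \<Psi> C\<^sub>1)" and ?p2 = "marginal \<Lambda> (cond_dist E L \<Psi> C\<^sub>2)"
    have fin\<Lambda>: "finite \<Lambda>" using \<Psi> \<Lambda> finite_subset by blast
    have V: "finite (L v)" "finite (E `` {v})" "vertex_degree E v \<le> \<Delta>" if "v \<in> \<Psi>" for v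
      using that \<Psi> assms(4) assms(5)[of v] finite_subset[of "L v" "{1..q}"]
      by (auto simp: has_max_degree_def)
    have good: "good (residual_lists E L C) \<Psi>" if "free_coloring E L (V - \<Psi>) C" for C
    proof (rule good_residual_lists)
      show "dom C \<inter> \<Psi> = {}" using that by (auto simp: free_coloring_def list_coloring_def)
    qed (use \<Psi> V assms(9) in auto)
    have g: "good ?l1 \<Psi>" "good ?l2 \<Psi>" using good C by auto
    have fin: "finite (set_pmf (marginal \<Lambda> (cond_dist E L \<Psi> C)))" if "good (residual_lists E L C) \<Psi>" for C
      using colorings_nonempty[OF that]
      by (simp add: marginal_def cond_dist_def compatible_colorings_eq)
    obtain f where f: "\<And>x. \<bar>f x\<bar> \<le> 1" and
      "tv_dist ?p1 ?p2 = measure_pmf.expectation ?p1 f - measure_pmf.expectation ?p2 f"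
      using tv_dist_eq_expectation[of "set_pmf ?p1 \<union> set_pmf ?p2" ?p1 ?p2] fin g by auto
    then have tv: "tv_dist ?p1 ?p2 = avg E ?l1 \<Psi> (\<lambda>c. f (c |` \<Lambda>)) - avg E ?l2 \<Psi> (\<lambda>c. f (c |` \<Lambda>))"
      using colorings_nonempty[OF g(1)] colorings_nonempty[OF g(2)]
      by (simp add: expectation_marginal_cond_dist)
    have deg: "deg E \<Psi> v \<le> \<Delta>" if "v \<in> \<Lambda>" for v
    proof -
      have "deg E \<Psi> v \<le> vertex_degree E v"
        unfolding deg_def vertex_degree_def using V(2) that \<Lambda> by (intro card_mono) auto
      then show ?thesis using V(3)[of v] that \<Lambda> by auto
    qed
    have far: "tv_dist ?p1 ?p2 \<le> card \<Lambda> * (M * \<rho> ^ n)" if "enat (Suc (Suc n)) \<le> set_dist E \<Lambda> W" for n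
      using avg_restrict_diff_le[where f = f, OF fin\<Lambda> \<Lambda> g f agree_residual_lists[OF W _ that] deg]
      unfolding tv M_def by (simp add: mult_ac abs_le_iff)
    have "\<bar>avg E \<l> \<Psi> (\<lambda>c. f (c |` \<Lambda>))\<bar> \<le> 1" if "good \<l> \<Psi>" for \<l>
      using that f by (rule abs_avg_le)
    from this[OF g(1)] this[OF g(2)] have near: "tv_dist ?p1 ?p2 \<le> 2"
      unfolding tv by linarith
    show "tv_dist ?p1 ?p2 \<le> A * real (card \<Lambda>) * exp_decay \<theta> (set_dist E \<Lambda> W)"
    proof (cases "set_dist E \<Lambda> W")
      case infinity
      \<comment> \<open>At infinite distance the bound \<open>far\<close> holds for every
        \<open>n\<close>, so the limit gives 0.\<close>
      have "(\<lambda>n. card \<Lambda> * (M * \<rho> ^ n)) \<longlonglongrightarrow> card \<Lambda> * (M * 0)"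
        using rho by (intro tendsto_intros LIMSEQ_realpow_zero) auto
      then have "tv_dist ?p1 ?p2 \<le> card \<Lambda> * (M * 0)"
        using far infinity by (intro LIMSEQ_le_const) auto
      then show ?thesis using infinity by (simp add: exp_decay_def)
    next
      case (enat m)
      \<comment> \<open>A finite distance excludes an empty \<open>\<Lambda>\<close>, so the trivial
        bound 2 may be multiplied by \<open>card \<Lambda>\<close>.\<close>
      then have "\<Lambda> \<noteq> {}" by (auto simp: set_dist_def top_enat_def)
      then have card: "1 \<le> real (card \<Lambda>)" using fin\<Lambda> by (simp add: Suc_le_eq card_gt_0_iff)
      show ?thesis
      proof (cases "m \<le> 1")
        case True
        then have "\<rho> ^ 1 \<le> \<rho> ^ m" using rho by (intro power_decreasing) auto
        then have "2 / \<rho> * \<rho> \<le> A * \<rho> ^ m"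
          using rho M by (intro mult_mono) (auto simp: A_def)
        then have "2 \<le> A * \<rho> ^ m" using rho by simp
        then have "2 * 1 \<le> (A * \<rho> ^ m) * card \<Lambda>" using card by (intro mult_mono) auto
        then show ?thesis using near by (simp add: enat exp_theta mult_ac)
      next
        case False
        then obtain n where m: "m = Suc (Suc n)" by (metis One_nat_def Suc_le_mono le0 not0_implies_Suc)
        have "M * \<rho> ^ n = M / \<rho>\<^sup>2 * \<rho> ^ m" using rho by (simp add: m power2_eq_square)
        also have "\<dots> \<le> A * \<rho> ^ m" using rho by (intro mult_right_mono) (auto simp: A_def)
        finally have "card \<Lambda> * (M * \<rho> ^ n) \<le> card \<Lambda> * (A * \<rho> ^ m)" by (intro mult_left_mono) auto
        then show ?thesis using far[of n] by (simp add: enat m exp_theta mult_ac)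
      qed
    qed
  qed
qed

end
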